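(* Let $0<\alpha<1$ and $1\le i\le k\le 6$. With $\omega^{(k,i)}(\xi)=\sum_{m\ge0}\omega^{(k,i)}_m\xi^m$ (which converges absolutely for $|\xi|\le1$) and the stability region $S^{(k,i)}$ defined in the context, $$S^{(k,i)}=\mathbb{C}\setminus\{\omega^{(k,i)}(\xi):\ |\xi|\le 1\}.$$
   Context: Uniform grid $t_n=n\Delta t$, $\Delta t>0$, $I_j=[t_{j-1},t_j]$. For a function $u$ and integers $m\ge1$, $j$, $q$, let $p^{m}_{j,q}$ be the polynomial of degree at most $m$ interpolating $u$ at $t_{j+q-m-1},\dots,t_{j+q-1}$. For $1\le i\le k\le 6$ and $n\ge k$, let $P^{k}_{i,n}$ be the continuous piecewise polynomial on $[0,t_n]$ equal on $I_j$ to $p^{k-1}_{j,k-j}$ for $1\le j\le k-i$, to $p^{k}_{j,i}$ for $k-i+1\le j\le n-i+1$, and to $p^{k}_{j,n+1-j}$ for $n-i+2\le j\le n$, and set $D^{\alpha}_{k,i}u_n=\frac{1}{\Gamma(1-\alpha)}\int_0^{t_n}(t_n-\xi)^{-\alpha}(P^{k}_{i,n})'(\xi)\,\mathrm{d}\xi$. This is a linear combination of $u_0,\dots,u_n$ ($u_j=u(t_j)$); for $k\le j\le n$ the coefficient of $u_j$ in $(\Delta t)^{\alpha}D^{\alpha}_{k,i}u_n$ depends only on $n-j$ and is denoted $\omega^{(k,i)}_{n-j}$ (defining $\omega^{(k,i)}_m$ for all $m\ge0$), and $w^{(k,i)}_{n,j}$ ($0\le j\le k-1$) are defined by $(\Delta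 t)^{\alpha}D^{\alpha}_{k,i}u_n=\sum_{j=0}^{k-1}w^{(k,i)}_{n,j}u_j+\sum_{j=0}^{n}\omega^{(k,i)}_{n-j}u_j$. Applying the method to ${}^{C}D^{\alpha}u=\lambda u$ gives, with $z=\lambda(\Delta t)^{\alpha}$, the recursion $\sum_{j=0}^{k-1}w^{(k,i)}_{n,j}u_j+\sum_{j=0}^{n}\omega^{(k,i)}_{n-j}u_j=z u_n$, $n\ge k$. The stability region $S^{(k,i)}$ is the set of $z\in\mathbb{C}$ such that for every choice of bounded starting values $u_0,\dots,u_{k-1}\in\mathbb{C}$ this recursion determines $(u_n)_{n\ge k}$ and $u_n\to0$ as $n\to\infty$. *)

theory Defs
  imports "HOL-Analysis.Analysis"
begin

definition tnode :: "real \<Rightarrow> int \<Rightarrow> real" where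
  "tnode dt l = of_int l * dt"

definition interp :: "real \<Rightarrow> (int \<Rightarrow> real) \<Rightarrow> nat \<Rightarrow> int \<Rightarrow> int \<Rightarrow> real \<Rightarrow> real" where
  "interp dt g m j q t =
     (\<Sum>l\<in>{j+q-int m-1..j+q-1}. g l *
        (\<Prod>r\<in>{j+q-int m-1..j+q-1}-{l}. (t - tnode dt r) / (tnode dt l - tnode dt r)))"

definition Ppiece :: "real \<Rightarrow> (int \<Rightarrow> real) \<Rightarrow> nat \<Rightarrow> nat \<Rightarrow> nat \<Rightarrow> nat \<Rightarrow> real \<Rightarrow> real" where
  "Ppiece dt g k i n j =
     (if j \<le> k - i then interp dt g (k-1) (int j) (int k - int j)
      else if j \<le> n - i + 1 then interp dt g k (int j) (int i)
      else interp dt g k (int j) (int n + 1 - int j))"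

text \<open>D^alpha_{k,i} u_n: the integral over [0,t_n] of the piecewise integrand,
  written as the sum of the integrals over the subintervals I_j.\<close>
definition Dfrac :: "real \<Rightarrow> real \<Rightarrow> nat \<Rightarrow> nat \<Rightarrow> (int \<Rightarrow> real) \<Rightarrow> nat \<Rightarrow> real" where
  "Dfrac alpha dt k i g n =
     1 / Gamma (1 - alpha) *
     (\<Sum>j=1..n. integral {tnode dt (int j - 1)..tnode dt (int j)}
        (\<lambda>\<xi>. (tnode dt (int n) - \<xi>) powr (- alpha) * deriv (Ppiece dt g k i n j) \<xi>))"

text \<open>Coefficient of u_j in (dt)^alpha D^alpha_{k,i} u_n (D is linear in the grid values).\<close>
definition coef :: "real \<Rightarrow> real \<Rightarrow> nat \<Rightarrow> nat \<Rightarrow> nat \<Rightarrow> nat \<Rightarrow> real" where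
  "coef alpha dt k i n j = dt powr alpha * Dfrac alpha dt k i (\<lambda>l. if l = int j then 1 else 0) n"

text \<open>omega^{(k,i)}_m: the coefficient of u_j for k \<le> j \<le> n, m = n - j (taken at j = k, n = m + k).\<close>
definition omega :: "real \<Rightarrow> real \<Rightarrow> nat \<Rightarrow> nat \<Rightarrow> nat \<Rightarrow> real" where
  "omega alpha dt k i m = coef alpha dt k i (m + k) k"

definition wcoef :: "real \<Rightarrow> real \<Rightarrow> nat \<Rightarrow> nat \<Rightarrow> nat \<Rightarrow> nat \<Rightarrow> real" where
  "wcoef alpha dt k i n j = coef alpha dt k i n j - omega alpha dt k i (n - j)"

text \<open>The recursion for the test equation with z = lambda dt^alpha.\<close>
definition recursion :: "real \<Rightarrow> real \<Rightarrow> nat \<Rightarrow> nat \<Rightarrow> complex \<Rightarrow> (nat \<Rightarrow> complex) \<Rightarrow> bool" where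
  "recursion alpha dt k i z u \<longleftrightarrow>
     (\<forall>n\<ge>k. (\<Sum>j<k. complex_of_real (wcoef alpha dt k i n j) * u j)
            + (\<Sum>j\<le>n. complex_of_real (omega alpha dt k i (n - j)) * u j) = z * u n)"

definition stab_region :: "real \<Rightarrow> real \<Rightarrow> nat \<Rightarrow> nat \<Rightarrow> complex set" where
  "stab_region alpha dt k i = {z. \<forall>s :: nat \<Rightarrow> complex.
      (\<exists>!u. (\<forall>j<k. u j = s j) \<and> recursion alpha dt k i z u) \<and>
      (\<forall>u. (\<forall>j<k. u j = s j) \<and> recursion alpha dt k i z u \<longrightarrow> u \<longlonglongrightarrow> 0)}"

end

theory Submission
  imports Defs "HOL-Complex_Analysis.Complex_Analysis" "HOL-Real_Asymp.Real_Asymp"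
begin

text \<open>
  Let U be the generating function of a solution. The recursion reads (\<omega> - z) U = G, where the
  coefficients of G tend to 0 because the weights of the starting values do.

  If z is not a value of \<omega> on the closed disc, Wiener's lemma shows that 1 / (\<omega> - z) has absolutely
  summable coefficients, and the convolution of such a sequence with a null sequence is a null sequence.

  Conversely let z = \<omega>(x) with |x| \<le> 1. The scheme annihilates constants, so \<omega>(1) = 0 and for
  z = 0 the constant sequence 1 is a solution. If z \<noteq> 0, then x \<noteq> 1; suppose the solution u
  with starting values 1 tends to 0. With V the generating function of u - 1 one has
  (1 - X) (\<omega> - z) V = z X^k, and Y = (1 - X) V has null coefficients.
  As \<omega>_(m+1) - \<omega>_m = O(m^(-2-\<alpha>)), the series (1 - X) (\<omega> - z), which vanishes at x, factors as
  (X - x) q with q absolutely summable. Hence p = q Y has null coefficients, whereas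
  (X - x) p = z (1 - X) X^k forces z (1 - x) = 0.
\<close>

section \<open>Wiener's lemma on the closed unit disc\<close>

text \<open>Bounding all partial sums, not the infinite sum, lets one inequality carry both
  convergence and size: a default value of a divergent sum can never pass for a norm.\<close>

definition l1_le :: "complex fps \<Rightarrow> real \<Rightarrow> bool" where
  "l1_le F B \<longleftrightarrow> (\<forall>N. (\<Sum>m\<le>N. cmod (fps_nth F m)) \<le> B)"

lemma l1_le_nonneg: "l1_le F B \<Longrightarrow> 0 \<le> B"
  unfolding l1_le_def by (meson order_trans sum_nonneg norm_ge_zero)

lemma l1_le_imp_summable: "l1_le F B \<Longrightarrow> summable (\<lambda>n. cmod (fps_nth F n))"
  unfolding l1_le_def by (intro bounded_imp_summable) auto

lemma summable_imp_l1_le: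
  assumes "summable (\<lambda>n. cmod (fps_nth F n))"
  shows "l1_le F (\<Sum>n. cmod (fps_nth F n))"
  unfolding l1_le_def using assms by (auto intro!: sum_le_suminf)

text \<open>The index triangle i + j <= N of the Cauchy product lies inside the square of side N,
  whose sum is the product of the two partial sums.\<close>

lemma l1_le_mult:
  assumes F: "l1_le F A" and G: "l1_le G B"
  shows "l1_le (F * G) (A * B)"
  unfolding l1_le_def
proof
  fix N
  let ?f = "\<lambda>n. cmod (fps_nth F n)" and ?g = "\<lambda>n. cmod (fps_nth G n)"
  have "(\<Sum>n\<le>N. cmod (fps_nth (F * G) n)) \<le> (\<Sum>n\<le>N. \<Sum>i\<le>n. ?f i * ?g (n - i))"
    unfolding fps_mult_nth atLeast0AtMost
    by (intro sum_mono order_trans[OF norm_sum]) (simp add: norm_mult)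
  also have "\<dots> = (\<Sum>(i,j)\<in>{(i,j). i + j \<le> N}. ?f i * ?g j)"
    using sum.triangle_reindex_eq[of "\<lambda>i j. ?f i * ?g j" N] by simp
  also have "\<dots> \<le> (\<Sum>(i,j)\<in>{..N} \<times> {..N}. ?f i * ?g j)"
    by (intro sum_mono2) auto
  also have "\<dots> = (\<Sum>i\<le>N. ?f i) * (\<Sum>j\<le>N. ?g j)"
    by (simp add: sum_product sum.cartesian_product)
  also have "\<dots> \<le> A * B"
    using F G l1_le_nonneg[OF F] unfolding l1_le_def by (intro mult_mono sum_nonneg) auto
  finally show "(\<Sum>n\<le>N. cmod (fps_nth (F * G) n)) \<le> A * B" .
qed

lemma l1_le_add:
  assumes "l1_le F A" "l1_le G B"
  shows "l1_le (F + G) (A + B)"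
  unfolding l1_le_def
proof
  fix N
  have "(\<Sum>n\<le>N. cmod (fps_nth (F + G) n)) \<le> (\<Sum>n\<le>N. cmod (fps_nth F n)) + (\<Sum>n\<le>N. cmod (fps_nth G n))"
    by (auto simp: sum.distrib[symmetric] intro!: sum_mono norm_triangle_ineq)
  also have "\<dots> \<le> A + B" using assms unfolding l1_le_def by (intro add_mono) auto
  finally show "(\<Sum>n\<le>N. cmod (fps_nth (F + G) n)) \<le> A + B" .
qed

lemma l1_le_0: "l1_le 0 0"
  by (simp add: l1_le_def)

lemma l1_le_1: "l1_le 1 1"
  by (auto simp: l1_le_def if_distrib[of cmod] sum.delta cong: if_cong)

lemma l1_le_uminus: "l1_le F A \<Longrightarrow> l1_le (- F) A"
  by (simp add: l1_le_def)

lemma l1_le_power: "l1_le F A \<Longrightarrow> l1_le (F ^ n) (A ^ n)"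
  by (induction n) (auto intro: l1_le_mult l1_le_1)

lemma ex_l1_le_sum_power: "l1_le F A \<Longrightarrow> \<exists>B. l1_le (\<Sum>j<n. F ^ j) B"
  by (induction n) (auto intro: l1_le_0 l1_le_add l1_le_power)

text \<open>Instead of summing a Neumann series, the identity b = 1 + b G is bootstrapped: a partial
  sum S of the norm of b satisfies S <= 1 + S q, which can be solved for S because q < 1.\<close>

lemma l1_le_inverse_one_minus:
  assumes G: "l1_le G q" and "q < 1"
  shows "l1_le (inverse (1 - G)) (1 / (1 - q))" "fps_nth (1 - G) 0 \<noteq> 0"
proof -
  have "cmod (fps_nth G 0) \<le> q" using G[unfolded l1_le_def, rule_format, of 0] by simp
  with \<open>q < 1\<close> have "fps_nth G 0 \<noteq> 1" by auto
  then show nz: "fps_nth (1 - G) 0 \<noteq> 0" by auto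
  define b where "b = inverse (1 - G)"
  have "b * (1 - G) = 1" unfolding b_def using nz by (rule inverse_mult_eq_1)
  then have b: "b = 1 + b * G" by (simp add: algebra_simps)
  show "l1_le (inverse (1 - G)) (1 / (1 - q))"
    unfolding l1_le_def b_def[symmetric]
  proof
    fix N
    let ?S = "\<Sum>m\<le>N. cmod (fps_nth b m)"
    \<comment> \<open>Truncation makes the norm finite a priori. Coefficients of b G up to N involve
      b only up to N, so replacing b by c does not change them.\<close>
    define c where "c = Abs_fps (\<lambda>m. if m \<le> N then fps_nth b m else 0)"
    have "l1_le c ?S"
      unfolding l1_le_def
    proof
      fix M
      have "(\<Sum>m\<le>M. cmod (fps_nth c m)) = (\<Sum>m\<in>{..M} \<inter> {..N}. cmod (fps_nth b m))"
        by (rule sum.mono_neutral_cong_right) (auto simp: c_def)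
      also have "\<dots> \<le> ?S" by (rule sum_mono2) auto
      finally show "(\<Sum>m\<le>M. cmod (fps_nth c m)) \<le> ?S" .
    qed
    then have "l1_le (1 + c * G) (1 + ?S * q)" by (intro l1_le_add l1_le_1 l1_le_mult G)
    then have "(\<Sum>m\<le>N. cmod (fps_nth (1 + c * G) m)) \<le> 1 + ?S * q" unfolding l1_le_def by blast
    moreover have "fps_nth (1 + c * G) m = fps_nth b m" if "m \<le> N" for m
      by (subst b) (use that in \<open>auto simp: fps_mult_nth c_def intro!: sum.cong\<close>)
    ultimately have "?S \<le> 1 + ?S * q" by simp
    then show "?S \<le> 1 / (1 - q)" using \<open>q < 1\<close> by (simp add: field_simps)
  qed
qed

text \<open>A point x of the larger disc is compared with its radial contraction x / R in the unit
  disc. The two are at distance at most R - 1, and uniform continuity on the disc of radius 2 limits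
  the change of p.\<close>

lemma poly_bounded_below_slightly_larger_disc:
  fixes p :: "complex poly"
  assumes low: "\<And>x. cmod x \<le> 1 \<Longrightarrow> a \<le> cmod (poly p x)" and "b < a"
  obtains R where "1 < R" "\<And>x. cmod x \<le> R \<Longrightarrow> b \<le> cmod (poly p x)"
proof -
  have "uniformly_continuous_on (cball 0 2) (poly p)"
    by (intro compact_uniformly_continuous continuous_intros) auto
  then obtain d where d: "d > 0"
    "\<And>x y. x \<in> cball 0 2 \<Longrightarrow> y \<in> cball 0 2 \<Longrightarrow> dist y x < d \<Longrightarrow> dist (poly p y) (poly p x) < a - b"
    unfolding uniformly_continuous_on_def using \<open>b < a\<close> by (metis diff_gt_0_iff_gt)
  define R where "R = 1 + min 1 (d/2)"
  have R: "1 < R" "R \<le> 2" "R - 1 < d" using d by (auto simp: R_def)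
  show ?thesis
  proof (rule that[OF \<open>1 < R\<close>])
    fix x assume x: "cmod x \<le> R"
    define y where "y = x / of_real R"
    have y: "cmod y \<le> 1" using x R by (simp add: y_def norm_divide)
    have "x - y = y * of_real (R - 1)" using R by (simp add: y_def field_simps)
    then have "cmod (x - y) = cmod y * (R - 1)" using R by (metis abs_of_nonneg diff_ge_0_iff_ge less_imp_le norm_mult norm_of_real)
    also have "\<dots> \<le> 1 * (R - 1)" using y R by (intro mult_right_mono) auto
    finally have "dist y x < d" using R by (simp add: dist_norm norm_minus_commute)
    then have "dist (poly p y) (poly p x) < a - b" using x y R by (intro d) auto
    moreover have "cmod (poly p y) \<le> cmod (poly p x) + dist (poly p y) (poly p x)"
      by (metis add.commute dist_norm norm_triangle_sub)
    ultimately show "b \<le> cmod (poly p x)" using low[OF y] by linarith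
  qed
qed

text \<open>Cauchy's estimate on the circle of radius R bounds the m-th coefficient by b^(-n)
  R^(-m), and the geometric series in m is summed. The factor R / (R - 1) does not depend on n, so a
  high power can absorb it.\<close>

lemma l1_le_inverse_poly_power:
  fixes p :: "complex poly"
  assumes low: "\<And>x. cmod x \<le> R \<Longrightarrow> b \<le> cmod (poly p x)" and "1 < R" "0 < b"
  shows "l1_le (inverse (fps_of_poly p) ^ n) (R / (R - 1) * (1 / b) ^ n)"
proof -
  define g where "g = (\<lambda>x. inverse (poly p x) ^ n)"
  have nz: "poly p x \<noteq> 0" if "cmod x \<le> R" for x using low[OF that] \<open>0 < b\<close> by auto
  have "poly p has_fps_expansion fps_of_poly p"
    using eval_fps_has_fps_expansion[of "fps_of_poly p"] by (simp add: eval_fps_of_poly[abs_def])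
  moreover have "fps_nth (fps_of_poly p) 0 \<noteq> 0" using nz[of 0] \<open>1 < R\<close> by (simp add: poly_0_coeff_0)
  ultimately have g: "g has_fps_expansion inverse (fps_of_poly p) ^ n"
    unfolding g_def by (intro has_fps_expansion_power has_fps_expansion_inverse)
  have coeff: "cmod (fps_nth (inverse (fps_of_poly p) ^ n) m) \<le> (1 / b) ^ n * (1 / R) ^ m" for m
  proof -
    have "cmod ((deriv ^^ m) g 0) \<le> fact m * (1 / b) ^ n / R ^ m"
    proof (rule Cauchy_inequality)
      show "g holomorphic_on ball 0 R" unfolding g_def using nz by (intro holomorphic_intros) auto
      show "continuous_on (cball 0 R) g" unfolding g_def using nz by (intro continuous_intros) auto
      show "0 < R" using \<open>1 < R\<close> by simp
      fix x :: complex assume "cmod (0 - x) = R"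
      then have "b \<le> cmod (poly p x)" by (intro low) auto
      then have "inverse (cmod (poly p x)) \<le> inverse b" using \<open>0 < b\<close> by (intro le_imp_inverse_le)
      then show "cmod (g x) \<le> (1 / b) ^ n"
        unfolding g_def norm_power norm_inverse inverse_eq_divide[symmetric] by (intro power_mono) auto
    qed
    then have "cmod ((deriv ^^ m) g 0) / fact m \<le> fact m * (1 / b) ^ n / R ^ m / fact m"
      by (intro divide_right_mono) auto
    then show ?thesis
      by (simp add: fps_nth_fps_expansion[OF g] norm_divide power_divide)
  qed
  show ?thesis unfolding l1_le_def
  proof
    fix N
    have "(\<Sum>m\<le>N. cmod (fps_nth (inverse (fps_of_poly p) ^ n) m)) \<le> (\<Sum>m\<le>N. (1 / b) ^ n * (1 / R) ^ m)"
      by (intro sum_mono coeff)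
    also have "\<dots> = (1 / b) ^ n * (\<Sum>m\<le>N. (1 / R) ^ m)" by (simp add: sum_distrib_left)
    also have "\<dots> \<le> (1 / b) ^ n * (\<Sum>m. (1 / R) ^ m)"
      using \<open>1 < R\<close> \<open>0 < b\<close> by (intro mult_left_mono sum_le_suminf) auto
    also have "(\<Sum>m. (1 / R) ^ m) = R / (R - 1)"
      using \<open>1 < R\<close> by (subst suminf_geometric) (auto simp: field_simps)
    finally show "(\<Sum>m\<le>N. cmod (fps_nth (inverse (fps_of_poly p) ^ n) m)) \<le> R / (R - 1) * (1 / b) ^ n"
      by (simp add: mult.commute)
  qed
qed

section \<open>Absolutely summable power series on the closed disc, and Newman's argument\<close>

lemma summable_power_series_closed_disc:
  fixes a :: "nat \<Rightarrow> complex"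
  assumes "summable (\<lambda>n. cmod (a n))" "cmod x \<le> 1"
  shows "summable (\<lambda>n. cmod (a n * x ^ n))"
proof (rule summable_comparison_test'[OF assms(1)])
  fix n
  have "cmod x ^ n \<le> 1" using assms by (intro power_le_one) auto
  then show "norm (cmod (a n * x ^ n)) \<le> cmod (a n)"
    using mult_left_mono[of "cmod x ^ n" 1 "cmod (a n)"] by (simp add: norm_mult norm_power)
qed

lemma continuous_on_power_series_closed_disc:
  fixes a :: "nat \<Rightarrow> complex"
  assumes "summable (\<lambda>n. cmod (a n))"
  shows "continuous_on (cball 0 1) (\<lambda>x. \<Sum>n. a n * x ^ n)"
proof (rule uniform_limit_theorem)
  show "uniform_limit (cball 0 1) (\<lambda>N x. \<Sum>n<N. a n * x ^ n) (\<lambda>x. \<Sum>n. a n * x ^ n) sequentially"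
  proof (rule Weierstrass_m_test[OF _ assms])
    fix n x assume "x \<in> cball (0::complex) 1"
    then have "cmod x ^ n \<le> 1" by (intro power_le_one) auto
    then show "cmod (a n * x ^ n) \<le> cmod (a n)"
      using mult_left_mono[of "cmod x ^ n" 1 "cmod (a n)"] by (simp add: norm_mult norm_power)
  qed
qed (auto intro!: always_eventually continuous_intros)

text \<open>Newman's argument: write f = P (1 + h) with P a polynomial close to f. Cauchy's estimates on a
  slightly larger disc bound the powers of 1 / P, so some power of h has norm less than 1.\<close>
theorem wiener_closed_disc:
  fixes f :: "complex fps"
  assumes sm: "summable (\<lambda>n. cmod (fps_nth f n))"
    and nz: "\<And>x. cmod x \<le> 1 \<Longrightarrow> (\<Sum>n. fps_nth f n * x ^ n) \<noteq> 0"
  shows "summable (\<lambda>n. cmod (fps_nth (inverse f) n))"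
proof -
  let ?ev = "\<lambda>x. \<Sum>n. fps_nth f n * x ^ n"
  have "\<exists>x\<in>cball 0 1. \<forall>y\<in>cball 0 1. cmod (?ev x) \<le> cmod (?ev y)"
    by (intro continuous_attains_inf continuous_on_norm continuous_on_power_series_closed_disc sm) auto
  then obtain x0 where x0: "cmod x0 \<le> 1" "\<And>y. cmod y \<le> 1 \<Longrightarrow> cmod (?ev x0) \<le> cmod (?ev y)" by auto
  define d where "d = cmod (?ev x0)"
  have "d > 0" using nz[OF x0(1)] by (simp add: d_def)
  have "\<exists>N. \<forall>n\<ge>N. norm (\<Sum>i. cmod (fps_nth f (i + n))) < d / 3"
    using \<open>d > 0\<close> by (intro suminf_exist_split sm) auto
  then obtain N where "norm (\<Sum>i. cmod (fps_nth f (i + N))) < d / 3" by blast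
  then have N: "(\<Sum>i. cmod (fps_nth f (i + N))) < d / 3" by simp
  \<comment> \<open>The cut-off makes the remainder smaller than d/3, with d the minimum of |f| on
    the closed disc. Hence |p| >= 2d/3 there and |p| >= d/2 on a slightly larger disc, and (d/3) /
    (d/2) = 2/3 < 1.\<close>
  define p where "p = poly_of_list (map (fps_nth f) [0..<N])"
  have coeff_p: "coeff p m = (if m < N then fps_nth f m else 0)" for m
    by (auto simp: p_def nth_default_def)
  define e where "e = f - fps_of_poly p"
  have e_nth: "fps_nth e m = (if m < N then 0 else fps_nth f m)" for m
    by (simp add: e_def coeff_p)
  have e_sm: "summable (\<lambda>n. cmod (fps_nth e n))"
    by (rule summable_comparison_test'[OF sm]) (auto simp: e_nth)
  have e_sum: "(\<Sum>n. cmod (fps_nth e n)) < d / 3"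
    using suminf_split_initial_segment[OF e_sm, of N] N by (simp add: e_nth)
  then have e_l1: "l1_le e (d / 3)"
    using summable_imp_l1_le[OF e_sm] unfolding l1_le_def by (meson less_imp_le order_trans)
  have p_low: "2 * d / 3 \<le> cmod (poly p x)" if x: "cmod x \<le> 1" for x
  proof -
    have se: "summable (\<lambda>n. fps_nth e n * x ^ n)"
      using summable_power_series_closed_disc[OF e_sm x] by (rule summable_norm_cancel)
    have sp: "(\<lambda>n. coeff p n * x ^ n) sums poly p x"
      using sums_eval_fps[of x "fps_of_poly p"] by simp
    have "(\<lambda>n. fps_nth f n * x ^ n) sums (poly p x + (\<Sum>n. fps_nth e n * x ^ n))"
      using sums_add[OF sp summable_sums[OF se]] by (simp add: e_def algebra_simps)
    then have ev: "?ev x = poly p x + (\<Sum>n. fps_nth e n * x ^ n)" by (rule sums_unique[symmetric])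
    have "cmod (\<Sum>n. fps_nth e n * x ^ n) \<le> (\<Sum>n. cmod (fps_nth e n))"
    proof (rule norm_suminf_le[OF _ e_sm])
      fix n
      have "cmod x ^ n \<le> 1" using x by (intro power_le_one) auto
      then show "cmod (fps_nth e n * x ^ n) \<le> cmod (fps_nth e n)"
        using mult_left_mono[of "cmod x ^ n" 1 "cmod (fps_nth e n)"] by (simp add: norm_mult norm_power)
    qed
    moreover have "d \<le> cmod (poly p x) + cmod (\<Sum>n. fps_nth e n * x ^ n)"
      using x0(2)[OF x] norm_triangle_ineq[of "poly p x" "\<Sum>n. fps_nth e n * x ^ n"]
      by (simp add: ev d_def)
    ultimately show ?thesis using e_sum by linarith
  qed
  obtain R where R: "1 < R" "\<And>x. cmod x \<le> R \<Longrightarrow> d / 2 \<le> cmod (poly p x)"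
    using poly_bounded_below_slightly_larger_disc[OF p_low, of "d / 2"] \<open>d > 0\<close> by auto
  note inv_p = l1_le_inverse_poly_power[OF R(2) R(1)]
  define P where "P = fps_of_poly p"
  have P0: "fps_nth P 0 \<noteq> 0" using p_low[of 0] \<open>d > 0\<close> by (auto simp: P_def poly_0_coeff_0)
  define h where "h = e * inverse P"
  have f_eq: "f = P * (1 + h)"
  proof -
    have "P * (1 + h) = P + e * (inverse P * P)" by (simp add: h_def algebra_simps)
    also have "inverse P * P = 1" using P0 by (rule inverse_mult_eq_1)
    finally show ?thesis by (simp add: e_def P_def)
  qed
  \<comment> \<open>The bound for h itself need not be below 1, because of the factor R / (R - 1).
    The powers decay geometrically, so some power of h can be handled by the Neumann bound.\<close>
  have h_pow: "l1_le ((- h) ^ n) (R / (R - 1) * (2 / 3) ^ n)" for n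
  proof -
    have "l1_le ((- e) ^ n * inverse P ^ n) ((d / 3) ^ n * (R / (R - 1) * (1 / (d / 2)) ^ n))"
      unfolding P_def using \<open>d > 0\<close> by (intro l1_le_mult l1_le_power l1_le_uminus e_l1 inv_p) auto
    also have "(- e) ^ n * inverse P ^ n = (- h) ^ n" by (simp add: h_def power_mult_distrib[symmetric])
    also have "(d / 3) ^ n * (R / (R - 1) * (1 / (d / 2)) ^ n) = R / (R - 1) * (d / 3 * (1 / (d / 2))) ^ n"
      by (simp only: power_mult_distrib mult_ac)
    also have "d / 3 * (1 / (d / 2)) = 2 / 3" using \<open>d > 0\<close> by simp
    finally show ?thesis .
  qed
  have "(\<lambda>n. R / (R - 1) * (2 / 3) ^ n) \<longlonglongrightarrow> 0"
    by (intro tendsto_mult_right_zero LIMSEQ_realpow_zero) auto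
  then have "eventually (\<lambda>n. R / (R - 1) * (2 / 3) ^ n < 1) sequentially"
    by (rule order_tendstoD) auto
  then obtain n where n: "R / (R - 1) * (2 / 3) ^ n < 1" by (auto simp: eventually_sequentially)
  note neumann = l1_le_inverse_one_minus[OF h_pow n]
  define g where "g = (- h) ^ n"
  define S where "S = (\<Sum>j<n. (- h) ^ j)"
  \<comment> \<open>The finite geometric sum reduces inverting 1 + h to inverting 1 -
    (-h)^n.\<close>
  have hS: "(1 + h) * S = 1 - g"
    using one_diff_power_eq[of "- h" n] by (simp add: g_def S_def)
  have "f * (S * inverse (1 - g) * inverse P) = (P * inverse P) * (((1 + h) * S) * inverse (1 - g))"
    by (subst f_eq) (simp add: mult_ac)
  also have "\<dots> = 1"
    unfolding hS using neumann(2) P0 by (simp add: g_def inverse_mult_eq_1')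
  finally have "inverse f = S * inverse (1 - g) * inverse P" by (rule fps_inverse_unique)
  moreover obtain B where "l1_le S B"
    using ex_l1_le_sum_power[OF h_pow[of 1]] unfolding S_def by auto
  moreover have "l1_le (inverse P) (R / (R - 1) * (1 / (d / 2)) ^ 1)"
    using inv_p[of 1] \<open>d > 0\<close> by (simp add: P_def)
  ultimately show ?thesis
    using neumann(1) unfolding g_def by (metis l1_le_mult l1_le_imp_summable)
qed

text \<open>Dominated convergence for series: each term F_j G_(n-j) tends to 0 as n grows and is
  dominated by |F_j| times a bound for G.\<close>

lemma l1_mult_c0:
  fixes F G :: "complex fps"
  assumes F: "summable (\<lambda>n. cmod (fps_nth F n))" and G: "fps_nth G \<longlonglongrightarrow> 0"
  shows "fps_nth (F * G) \<longlonglongrightarrow> 0"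
proof -
  obtain M where M: "\<And>n. cmod (fps_nth G n) \<le> M"
    using convergent_imp_Bseq[OF convergentI[OF G]] by (auto simp: Bseq_def)
  have M0: "0 \<le> M" using M[of 0] norm_ge_zero order_trans by blast
  \<comment> \<open>Padding by 0 beyond j = n turns the finite convolutions into series over a fixed
    index set, as Tannery's theorem requires.\<close>
  define a where "a = (\<lambda>j n. if j \<le> n then fps_nth F j * fps_nth G (n - j) else 0)"
  have "(\<lambda>n. a j n) \<longlonglongrightarrow> 0" for j
  proof (rule Lim_transform_eventually)
    have "(\<lambda>n. fps_nth G (n - j)) \<longlonglongrightarrow> 0"
      by (rule LIMSEQ_offset[of _ j]) (simp add: G)
    then show "(\<lambda>n. fps_nth F j * fps_nth G (n - j)) \<longlonglongrightarrow> 0" by (rule tendsto_mult_right_zero)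
    show "eventually (\<lambda>n. fps_nth F j * fps_nth G (n - j) = a j n) sequentially"
      using eventually_ge_at_top[of j] by eventually_elim (simp add: a_def)
  qed
  moreover have "cmod (a j n) \<le> cmod (fps_nth F j) * M" for j n
    using M M0 by (auto simp: a_def norm_mult intro!: mult_left_mono)
  ultimately have "(\<lambda>n. \<Sum>j. a j n) \<longlonglongrightarrow> (\<Sum>j. 0)"
    by (intro tannerys_theorem[where M = "\<lambda>j. cmod (fps_nth F j) * M", THEN conjunct2, THEN conjunct2]
        summable_mult2 F always_eventually) auto
  moreover have "(\<Sum>j. a j n) = fps_nth (F * G) n" for n
    unfolding fps_mult_nth by (subst suminf_finite[of "{0..n}"]) (auto simp: a_def)
  ultimately show ?thesis by simp
qed

section \<open>Lagrange interpolation and the coefficients of the scheme\<close>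

definition nodes :: "nat \<Rightarrow> int \<Rightarrow> int \<Rightarrow> int set" where
  "nodes m j q = {j + q - int m - 1..j + q - 1}"

text \<open>A formal polynomial, unlike the function \<open>interp\<close>, has a degree and a
  formal derivative; uniqueness of interpolation and smoothness of the integrands come from
  these.\<close>

definition lagrange_poly :: "real \<Rightarrow> int set \<Rightarrow> int \<Rightarrow> real poly" where
  "lagrange_poly dt A l = (\<Prod>r\<in>A - {l}. smult (1 / (tnode dt l - tnode dt r)) [:- tnode dt r, 1:])"

definition interp_poly :: "real \<Rightarrow> (int \<Rightarrow> real) \<Rightarrow> nat \<Rightarrow> int \<Rightarrow> int \<Rightarrow> real poly" where
  "interp_poly dt g m j q = (\<Sum>l\<in>nodes m j q. smult (g l) (lagrange_poly dt (nodes m j q) l))"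

lemma interp_eq_poly: "interp dt g m j q = poly (interp_poly dt g m j q)"
  by (rule ext)
    (simp add: interp_def interp_poly_def lagrange_poly_def nodes_def poly_sum poly_prod diff_divide_distrib)

lemma degree_interp_poly: "degree (interp_poly dt g m j q) \<le> m"
proof -
  have "degree (lagrange_poly dt (nodes m j q) l) \<le> m" if "l \<in> nodes m j q" for l
  proof -
    have "degree (lagrange_poly dt (nodes m j q) l) \<le> (\<Sum>r\<in>nodes m j q - {l}. 1)"
      unfolding lagrange_poly_def
    proof (rule order_trans[OF degree_prod_sum_le])
      show "sum (degree \<circ> (\<lambda>r. smult (1 / (tnode dt l - tnode dt r)) [:- tnode dt r, 1:])) (nodes m j q - {l})
        \<le> (\<Sum>r\<in>nodes m j q - {l}. 1)"
        by (rule sum_mono) (simp del: smult_pCons)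
    qed (simp add: nodes_def)
    also have "\<dots> = m" using that by (simp add: nodes_def)
    finally show ?thesis .
  qed
  then show ?thesis unfolding interp_poly_def
    by (intro degree_sum_le) (auto simp: nodes_def intro!: order_trans[OF degree_smult_le])
qed

lemma interp_node:
  assumes "0 < dt" "l \<in> nodes m j q"
  shows "interp dt g m j q (tnode dt l) = g l"
proof -
  have *: "(\<Prod>r\<in>nodes m j q - {x}. (tnode dt l - tnode dt r) / (tnode dt x - tnode dt r))
      = (if x = l then 1 else 0)" for x
  proof (cases "x = l")
    case True
    then show ?thesis using assms(1) by (auto intro!: prod.neutral simp: tnode_def)
  next
    case False
    then show ?thesis using assms(2) by (auto intro!: prod_zero bexI[of _ l] simp: nodes_def)
  qed
  show ?thesis
    unfolding interp_def nodes_def[symmetric] *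
    using assms(2) by (simp add: if_distrib[of "times _"] nodes_def cong: if_cong)
qed

lemma interp_eq_0: "(\<And>l. l \<in> nodes m j q \<Longrightarrow> g l = 0) \<Longrightarrow> interp dt g m j q = (\<lambda>_. 0)"
  by (rule ext) (auto simp: interp_def nodes_def intro!: sum.neutral)

text \<open>The interpolant has degree at most m and agrees with the constant 1 at m + 1 distinct
  nodes.\<close>

lemma interp_eq_1:
  assumes "0 < dt" "\<And>l. l \<in> nodes m j q \<Longrightarrow> g l = 1"
  shows "interp dt g m j q = (\<lambda>_. 1)"
proof -
  have "inj_on (tnode dt) (nodes m j q)" using assms(1) by (auto simp: inj_on_def tnode_def)
  then have card: "card (tnode dt ` nodes m j q) = Suc m" by (simp add: card_image nodes_def)
  have "interp_poly dt g m j q = 1"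
  proof (rule poly_eqI_degree[of "tnode dt ` nodes m j q"])
    fix x assume "x \<in> tnode dt ` nodes m j q"
    then show "poly (interp_poly dt g m j q) x = poly 1 x"
      using interp_node[OF assms(1), of _ m j q g] assms(2) by (auto simp: interp_eq_poly)
  qed (use card degree_interp_poly[of dt g m j q] in auto)
  then show ?thesis by (simp add: interp_eq_poly fun_eq_iff)
qed

text \<open>Only differences of nodes enter the Lagrange products. On a uniform grid this makes
  interpolation translation invariant, which is why the weights depend on n - j alone.\<close>

lemma interp_shift:
  "interp dt (\<lambda>l. g (l - d)) m (j + d) q (t + tnode dt d) = interp dt g m j q t"
proof -
  have im: "nodes m (j + d) q = (\<lambda>l. l + d) ` nodes m j q"
    by (simp add: nodes_def algebra_simps)
  have im': "(\<lambda>l. l + d) ` A - {l + d} = (\<lambda>l. l + d) ` (A - {l})" for A l by auto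
  have "(\<Prod>r\<in>(\<lambda>l. l + d) ` nodes m j q - {l + d}. (t + tnode dt d - tnode dt r) / (tnode dt (l + d) - tnode dt r))
    = (\<Prod>r\<in>nodes m j q - {l}. (t - tnode dt r) / (tnode dt l - tnode dt r))" for l
    unfolding im' by (subst prod.reindex) (auto simp: tnode_def algebra_simps)
  then show ?thesis
    unfolding interp_def nodes_def[symmetric] im by (subst sum.reindex) auto
qed

lemma interp_sum:
  "finite A \<Longrightarrow> interp dt (\<lambda>x. \<Sum>a\<in>A. g a x) m j q t = (\<Sum>a\<in>A. interp dt (g a) m j q t)"
  unfolding interp_def sum_distrib_right by (rule sum.swap)

section \<open>The polynomial pieces: locality and translation invariance\<close>

definition Ppoly :: "real \<Rightarrow> (int \<Rightarrow> real) \<Rightarrow> nat \<Rightarrow> nat \<Rightarrow> nat \<Rightarrow> nat \<Rightarrow> real poly" where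
  "Ppoly dt g k i n j =
     (if j \<le> k - i then interp_poly dt g (k-1) (int j) (int k - int j)
      else if j \<le> n - i + 1 then interp_poly dt g k (int j) (int i)
      else interp_poly dt g k (int j) (int n + 1 - int j))"

lemma Ppiece_eq_poly: "Ppiece dt g k i n j = poly (Ppoly dt g k i n j)"
  by (simp add: Ppiece_def Ppoly_def interp_eq_poly)

lemma deriv_Ppiece: "deriv (Ppiece dt g k i n j) = poly (pderiv (Ppoly dt g k i n j))"
  unfolding Ppiece_eq_poly by (rule ext) (auto intro!: DERIV_imp_deriv poly_DERIV)

text \<open>Packages what the three cases have in common: the stencil stays within the available
  data and contains both endpoints of the interval. The first property gives reproduction of
  constants, the second the nodal values used for telescoping.\<close>

lemma Ppiece_interp:
  assumes "1 \<le> i" "i \<le> k" "k \<le> n" "1 \<le> j" "j \<le> n"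
  obtains m q where "\<And>dt g. Ppiece dt g k i n j = interp dt g m (int j) q"
    "nodes m (int j) q \<subseteq> {0..int n}" "int j - 1 \<in> nodes m (int j) q" "int j \<in> nodes m (int j) q"
proof (cases "j \<le> k - i")
  case True
  show ?thesis
    by (rule that[of "k - 1" "int k - int j"]) (use True assms in \<open>auto simp: Ppiece_def nodes_def\<close>)
next
  case not1: False
  show ?thesis
  proof (cases "j \<le> n - i + 1")
    case True
    show ?thesis
      by (rule that[of k "int i"]) (use not1 True assms in \<open>auto simp: Ppiece_def nodes_def\<close>)
  next
    case False
    show ?thesis
      by (rule that[of k "int n + 1 - int j"]) (use not1 False assms in \<open>auto simp: Ppiece_def nodes_def\<close>)
  qed
qed

abbreviation unit_data :: "nat \<Rightarrow> int \<Rightarrow> real" where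
  "unit_data l \<equiv> (\<lambda>x. if x = int l then 1 else 0)"

text \<open>Here j + i <= n excludes the last case, so the rightmost node of the stencil is k - 1 or
  j + i - 1, both to the left of l.\<close>

lemma Ppiece_unit_data_eq_0_left:
  assumes "1 \<le> i" "i \<le> k" "k \<le> l" "l \<le> n" "j + i \<le> l"
  shows "Ppiece dt (unit_data l) k i n j = (\<lambda>_. 0)"
  using assms by (auto simp: Ppiece_def nodes_def intro!: interp_eq_0)

text \<open>The leftmost node of the stencil is j + i - k - 1 or n - k, both beyond k. Thus the
  weight of an early value comes from the first 2k intervals only, however large n is.\<close>

lemma Ppiece_unit_data_eq_0_right:
  assumes "1 \<le> i" "i \<le> k" "l \<le> k" "3 * k \<le> n" "2 * k < j"
  shows "Ppiece dt (unit_data l) k i n j = (\<lambda>_. 0)"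
  using assms by (auto simp: Ppiece_def nodes_def intro!: interp_eq_0)

text \<open>For j <= 2k and n >= 3k the right-end case, the only one whose stencil involves n, does
  not occur; 3k serves as the reference index.\<close>

lemma Ppiece_indep_n:
  assumes "i \<le> k" "1 \<le> k" "3 * k \<le> n" "j \<le> 2 * k"
  shows "Ppiece dt g k i n j = Ppiece dt g k i (3 * k) j"
  using assms by (auto simp: Ppiece_def)

text \<open>The condition k - i < j excludes the starting pieces, whose stencil 0, ..., k - 1 does
  not move with the interval.\<close>

lemma Ppiece_shift:
  assumes "1 \<le> i" "i \<le> k" "k \<le> n" "k - i < j"
  shows "Ppiece dt (unit_data (k + d)) k i (n + d) (j + d) (t + tnode dt (int d)) = Ppiece dt (unit_data k) k i n j t"
proof -
  have u: "unit_data (k + d) = (\<lambda>l. unit_data k (l - int d))" by auto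
  show ?thesis
    using assms interp_shift[of dt "unit_data k" "int d" k "int j" "int i" t]
      interp_shift[of dt "unit_data k" "int d" k "int j" "int n + 1 - int j" t]
    unfolding u by (auto simp: Ppiece_def add_diff_eq)
qed

section \<open>The weights as sums of weakly singular integrals\<close>

abbreviation piece_integral where
  "piece_integral alpha dt k i l n j \<equiv> integral {tnode dt (int j - 1)..tnode dt (int j)}
     (\<lambda>\<xi>. (tnode dt (int n) - \<xi>) powr (- alpha) * deriv (Ppiece dt (unit_data l) k i n j) \<xi>)"

lemma coef_altdef:
  "coef alpha dt k i n l = dt powr alpha / Gamma (1 - alpha) * (\<Sum>j=1..n. piece_integral alpha dt k i l n j)"
  by (simp add: coef_def Dfrac_def)

lemma piece_integral_shift:
  assumes "1 \<le> i" "i \<le> k" "k \<le> n" "1 \<le> j"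
  shows "piece_integral alpha dt k i (k + d) (n + d) (j + d) = piece_integral alpha dt k i k n j"
proof (cases "j \<le> k - i")
  case True
  \<comment> \<open>Starting pieces are not translation invariant, but unit data at k does not reach
    them, nor does its translate reach the shifted interval; both integrals vanish.\<close>
  then have "Ppiece dt (unit_data (k + d)) k i (n + d) (j + d) = (\<lambda>_. 0)"
    "Ppiece dt (unit_data k) k i n j = (\<lambda>_. 0)"
    using assms by (intro Ppiece_unit_data_eq_0_left; simp)+
  then show ?thesis by (simp cong del: if_weak_cong)
next
  case False
  define f where "f = Ppiece dt (unit_data (k + d)) k i (n + d) (j + d)"
  define h where "h = Ppiece dt (unit_data k) k i n j"
  have h: "h = (\<lambda>t. f (t + tnode dt (int d)))"
    using Ppiece_shift[OF assms(1-3), of j dt d] False by (auto simp: f_def h_def)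
  have "deriv h t = deriv f (t + tnode dt (int d))" for t
  proof (rule DERIV_imp_deriv)
    have "(f has_real_derivative deriv f (t + tnode dt (int d))) (at (t + tnode dt (int d)))"
      unfolding f_def deriv_Ppiece unfolding Ppiece_eq_poly by (rule poly_DERIV)
    then show "(h has_real_derivative deriv f (t + tnode dt (int d))) (at t)"
      unfolding h by (simp add: DERIV_shift)
  qed
  then have "(\<lambda>\<xi>. (tnode dt (int n) - \<xi>) powr (- alpha) * deriv h \<xi>) =
     (\<lambda>\<xi>. (tnode dt (int (n + d)) - (\<xi> + tnode dt (int d))) powr (- alpha) * deriv f (\<xi> + tnode dt (int d)))"
    by (auto simp: tnode_def algebra_simps)
  then show ?thesis
    unfolding f_def[symmetric] h_def[symmetric]
    using integral_shift_Icc_real[of "tnode dt (int j - 1)" "tnode dt (int j)"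
       "\<lambda>\<xi>. (tnode dt (int (n + d)) - \<xi>) powr (- alpha) * deriv f \<xi>" "tnode dt (int d)"]
    by (simp add: tnode_def algebra_simps o_def)
qed

text \<open>Moving the unit data from k to l translates everything by d = l - k; the first d
  intervals, which have no preimage, contribute nothing. This justifies reading off
  \<open>omega\<close> at index k only.\<close>

lemma coef_eq_omega:
  assumes "1 \<le> i" "i \<le> k" "k \<le> l" "l \<le> n"
  shows "coef alpha dt k i n l = omega alpha dt k i (n - l)"
proof -
  define d where "d = l - k"
  define n' where "n' = n - d"
  have n: "n = n' + d" "l = k + d" "k \<le> n'" "n - l = n' - k" using assms by (auto simp: d_def n'_def)
  have "(\<Sum>j=1..n' + d. piece_integral alpha dt k i l n j)
     = (\<Sum>j=1+d..n' + d. piece_integral alpha dt k i l n j)"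
  proof (rule sum.mono_neutral_right)
    show "\<forall>j\<in>{1..n' + d} - {1 + d..n' + d}. piece_integral alpha dt k i l n j = 0"
    proof
      fix j assume "j \<in> {1..n' + d} - {1 + d..n' + d}"
      then have "Ppiece dt (unit_data l) k i n j = (\<lambda>_. 0)"
        using assms n by (intro Ppiece_unit_data_eq_0_left) auto
      then show "piece_integral alpha dt k i l n j = 0" by simp
    qed
  qed auto
  also have "\<dots> = (\<Sum>j=1..n'. piece_integral alpha dt k i l n (j + d))"
    by (rule sum.shift_bounds_cl_nat_ivl)
  also have "\<dots> = (\<Sum>j=1..n'. piece_integral alpha dt k i k n' j)"
    unfolding n using assms n by (intro sum.cong piece_integral_shift) auto
  finally show ?thesis unfolding omega_def coef_altdef using n by simp
qed

lemma powr_times_poly_integrable: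
  fixes p :: "real poly"
  assumes "alpha < 1" "b \<le> T"
  shows "(\<lambda>x. (T - x) powr (- alpha) * poly p x) integrable_on {a..b}"
proof (cases "a \<le> b")
  case True
  have "((\<lambda>x. x powr (- alpha)) integrable_on cbox 0 (T - a))"
    using integrable_on_powr_from_0[of "- alpha" "T - a"] assms True by simp
  from integrable_affinity[OF this, of "-1" T]
  have "(\<lambda>x. (T - x) powr (- alpha)) integrable_on (\<lambda>x. T - x) ` {0..T - a}"
    by (simp add: algebra_simps)
  also have "(\<lambda>x. T - x) ` {0..T - a} = {a..T}" using assms True by auto
  finally have "(\<lambda>x. (T - x) powr (- alpha)) integrable_on {a..b}"
    by (rule integrable_on_subinterval) (use assms in auto)
  then have "(\<lambda>x. (T - x) powr (- alpha)) absolutely_integrable_on {a..b}"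
    by (intro nonnegative_absolutely_integrable_1) auto
  moreover have "poly p \<in> borel_measurable (lebesgue_on {a..b})"
    by (intro continuous_imp_measurable_on_sets_lebesgue continuous_intros) auto
  moreover have "bounded (poly p ` {a..b})"
    by (intro compact_imp_bounded compact_continuous_image continuous_intros) auto
  ultimately have "(\<lambda>x. poly p x * (T - x) powr (- alpha)) absolutely_integrable_on {a..b}"
    by (intro absolutely_integrable_bounded_measurable_product_real) auto
  then show ?thesis by (simp add: mult.commute absolutely_integrable_on_def)
qed (simp add: integrable_on_empty)

text \<open>The unit data add up to 1 on every stencil, so on each interval the pieces add up to the
  constant 1, whose derivative is 0.\<close>

lemma sum_coef_eq_0:
  assumes "alpha < 1" "0 < dt" "1 \<le> i" "i \<le> k" "k \<le> n"
  shows "(\<Sum>l\<le>n. coef alpha dt k i n l) = 0"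
proof -
  have "(\<Sum>l\<le>n. piece_integral alpha dt k i l n j) = 0" if j: "j \<in> {1..n}" for j
  proof -
    obtain m q where mq: "\<And>g. Ppiece dt g k i n j = interp dt g m (int j) q"
      "nodes m (int j) q \<subseteq> {0..int n}"
      using Ppiece_interp[OF assms(3-5), of j] j by (metis atLeastAtMost_iff)
    have "poly (\<Sum>l\<le>n. Ppoly dt (unit_data l) k i n j) t = 1" for t
    proof -
      have "poly (\<Sum>l\<le>n. Ppoly dt (unit_data l) k i n j) t = (\<Sum>l\<le>n. Ppiece dt (unit_data l) k i n j t)"
        by (simp add: poly_sum Ppiece_eq_poly)
      also have "\<dots> = interp dt (\<lambda>x. \<Sum>l\<le>n. unit_data l x) m (int j) q t"
        by (simp add: mq interp_sum)
      also have "\<dots> = 1"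
      proof -
        have "(\<Sum>l\<le>n. unit_data l x) = 1" if "x \<in> nodes m (int j) q" for x
        proof -
          have "x = int (nat x)" "nat x \<le> n" using subsetD[OF mq(2) that] by auto
          then have "(\<Sum>l\<le>n. unit_data l x) = (\<Sum>l\<le>n. if l = nat x then 1 else 0)"
            by (intro sum.cong) auto
          then show ?thesis using \<open>nat x \<le> n\<close> by simp
        qed
        then show ?thesis by (simp add: interp_eq_1[OF assms(2)])
      qed
      finally show ?thesis .
    qed
    then have "poly (\<Sum>l\<le>n. Ppoly dt (unit_data l) k i n j) = poly 1" by auto
    then have "(\<Sum>l\<le>n. Ppoly dt (unit_data l) k i n j) = 1"
      by (simp only: poly_eq_poly_eq_iff)
    then have pd: "(\<Sum>l\<le>n. pderiv (Ppoly dt (unit_data l) k i n j)) = 0"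
      using higher_pderiv_sum[of 1 "\<lambda>l. Ppoly dt (unit_data l) k i n j" "{..n}"] by simp
    have "(\<Sum>l\<le>n. piece_integral alpha dt k i l n j) =
      integral {tnode dt (int j - 1)..tnode dt (int j)} (\<lambda>\<xi>. \<Sum>l\<le>n.
        (tnode dt (int n) - \<xi>) powr (- alpha) * deriv (Ppiece dt (unit_data l) k i n j) \<xi>)"
      unfolding deriv_Ppiece using assms j
      by (intro integral_sum[symmetric] powr_times_poly_integrable) (auto simp: tnode_def)
    also have "\<dots> = integral {tnode dt (int j - 1)..tnode dt (int j)} (\<lambda>\<xi>.
        (tnode dt (int n) - \<xi>) powr (- alpha) * poly (\<Sum>l\<le>n. pderiv (Ppoly dt (unit_data l) k i n j)) \<xi>)"
      unfolding deriv_Ppiece by (simp add: poly_sum sum_distrib_left)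
    also have "\<dots> = 0" unfolding pd by simp
    finally show ?thesis .
  qed
  then show ?thesis
    unfolding coef_altdef sum_distrib_left[symmetric] by (subst sum.swap) simp
qed

section \<open>Decay of the weights\<close>

lemma powr_minus_diff_bound:
  fixes a c x y :: real
  assumes "0 < a" "0 < c" "c \<le> x" "c \<le> y"
  shows "\<bar>x powr (- a) - y powr (- a)\<bar> \<le> a * c powr (- a - 1) * \<bar>x - y\<bar>"
proof -
  have "norm (x powr (- a) - y powr (- a)) \<le> a * c powr (- a - 1) * norm (x - y)"
  proof (rule field_differentiable_bound[of "{c..}" _ "\<lambda>s. - a * s powr (- a - 1)"])
    fix s assume s: "s \<in> {c..}"
    then show "((\<lambda>s. s powr (- a)) has_real_derivative - a * s powr (- a - 1)) (at s within {c..})"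
      using assms by (auto intro!: derivative_eq_intros)
    show "norm (- a * s powr (- a - 1)) \<le> a * c powr (- a - 1)"
      using s assms by (auto simp: abs_mult intro!: mult_left_mono powr_mono2')
  qed (use assms in auto)
  then show ?thesis by simp
qed

text \<open>The mean value inequality is used twice: the derivative of the first difference is
  itself a first difference, with exponent a + 1.\<close>

lemma powr_minus_second_diff_bound:
  fixes a c d x y :: real
  assumes "0 < a" "0 < c" "c \<le> x" "c \<le> y" "0 \<le> d"
  shows "\<bar>((x + d) powr (- a) - x powr (- a)) - ((y + d) powr (- a) - y powr (- a))\<bar>
    \<le> a * ((a + 1) * c powr (- a - 2) * d) * \<bar>x - y\<bar>"
proof -
  define H where "H = (\<lambda>s. (s + d) powr (- a) - s powr (- a))"
  have "norm (H x - H y) \<le> a * ((a + 1) * c powr (- a - 2) * d) * norm (x - y)"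
  proof (rule field_differentiable_bound[of "{c..}" _ "\<lambda>s. a * (s powr (- (a + 1)) - (s + d) powr (- (a + 1)))"])
    fix s assume s: "s \<in> {c..}"
    show "(H has_real_derivative a * (s powr (- (a + 1)) - (s + d) powr (- (a + 1)))) (at s within {c..})"
      unfolding H_def using s assms by (auto intro!: derivative_eq_intros simp: right_diff_distrib)
    have "\<bar>s powr (- (a + 1)) - (s + d) powr (- (a + 1))\<bar> \<le> (a + 1) * c powr (- (a + 1) - 1) * \<bar>s - (s + d)\<bar>"
      using s assms by (intro powr_minus_diff_bound) auto
    also have "- (a + 1) - 1 = - a - 2" by simp
    finally show "norm (a * (s powr (- (a + 1)) - (s + d) powr (- (a + 1)))) \<le> a * ((a + 1) * c powr (- a - 2) * d)"
      using assms by (simp add: abs_mult mult_left_mono)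
  qed (use assms in auto)
  then show ?thesis by (simp add: H_def)
qed

text \<open>The constant is fixed before the kernel is chosen, so one constant serves the kernels
  for all n.\<close>

lemma sum_integral_poly_bound:
  fixes p :: "'a \<Rightarrow> real poly" and a b :: "'a \<Rightarrow> real"
  assumes "finite J" "\<And>j. j \<in> J \<Longrightarrow> a j \<le> b j"
  obtains C where "0 \<le> C"
    "\<And>\<phi> E. (\<And>j x. j \<in> J \<Longrightarrow> x \<in> {a j..b j} \<Longrightarrow> \<bar>\<phi> x\<bar> \<le> E) \<Longrightarrow>
       (\<And>j. j \<in> J \<Longrightarrow> continuous_on {a j..b j} \<phi>) \<Longrightarrow> 0 \<le> E \<Longrightarrow>
       \<bar>\<Sum>j\<in>J. integral {a j..b j} (\<lambda>x. \<phi> x * poly (p j) x)\<bar> \<le> C * E"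
proof -
  have "\<forall>j. \<exists>M. 0 \<le> M \<and> (\<forall>x\<in>{a j..b j}. \<bar>poly (p j) x\<bar> \<le> M)"
  proof
    fix j
    have "bounded (poly (p j) ` {a j..b j})"
      by (intro compact_imp_bounded compact_continuous_image continuous_intros) auto
    then obtain M where "\<forall>x\<in>{a j..b j}. \<bar>poly (p j) x\<bar> \<le> M" by (auto simp: bounded_iff)
    then show "\<exists>M. 0 \<le> M \<and> (\<forall>x\<in>{a j..b j}. \<bar>poly (p j) x\<bar> \<le> M)"
      by (intro exI[of _ "max 0 M"]) (auto simp: le_max_iff_disj)
  qed
  then obtain M where M: "\<And>j. 0 \<le> M j" "\<And>j x. x \<in> {a j..b j} \<Longrightarrow> \<bar>poly (p j) x\<bar> \<le> M j" by metis
  show ?thesis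
  proof (rule that[of "\<Sum>j\<in>J. M j * (b j - a j)"])
    show "0 \<le> (\<Sum>j\<in>J. M j * (b j - a j))" using M assms by (intro sum_nonneg) auto
    fix \<phi> :: "real \<Rightarrow> real" and E :: real
    assume bd: "\<And>j x. j \<in> J \<Longrightarrow> x \<in> {a j..b j} \<Longrightarrow> \<bar>\<phi> x\<bar> \<le> E"
      and cont: "\<And>j. j \<in> J \<Longrightarrow> continuous_on {a j..b j} \<phi>" and "0 \<le> E"
    have "\<bar>integral {a j..b j} (\<lambda>x. \<phi> x * poly (p j) x)\<bar> \<le> M j * (b j - a j) * E" if j: "j \<in> J" for j
    proof -
      have "norm (integral {a j..b j} (\<lambda>x. \<phi> x * poly (p j) x)) \<le> E * M j * (b j - a j)"
      proof (rule integral_bound)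
        show "continuous_on {a j..b j} (\<lambda>x. \<phi> x * poly (p j) x)" by (intro continuous_intros cont j)
        show "norm (\<phi> x * poly (p j) x) \<le> E * M j" if "x \<in> {a j..b j}" for x
          using bd[OF j that] M(2)[OF that] \<open>0 \<le> E\<close> by (simp add: abs_mult mult_mono)
      qed (use assms j in auto)
      then show ?thesis by (simp add: mult_ac)
    qed
    then have "\<bar>\<Sum>j\<in>J. integral {a j..b j} (\<lambda>x. \<phi> x * poly (p j) x)\<bar> \<le> (\<Sum>j\<in>J. M j * (b j - a j) * E)"
      by (intro order_trans[OF sum_abs] sum_mono) auto
    then show "\<bar>\<Sum>j\<in>J. integral {a j..b j} (\<lambda>x. \<phi> x * poly (p j) x)\<bar> \<le> (\<Sum>j\<in>J. M j * (b j - a j)) * E"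
      by (simp add: sum_distrib_right)
  qed
qed

text \<open>With the pieces frozen at index 3k this is a linear functional independent of n; for n
  >= 3k the dependence of the weights on n sits entirely in the kernel.\<close>

definition kernel_sum :: "real \<Rightarrow> nat \<Rightarrow> nat \<Rightarrow> nat \<Rightarrow> (real \<Rightarrow> real) \<Rightarrow> real" where
  "kernel_sum dt k i l \<phi> = (\<Sum>j=1..2*k. integral {tnode dt (int j - 1)..tnode dt (int j)}
     (\<lambda>\<xi>. \<phi> \<xi> * poly (pderiv (Ppoly dt (unit_data l) k i (3 * k) j)) \<xi>))"

lemma coef_eq_kernel_sum:
  assumes "1 \<le> i" "i \<le> k" "l \<le> k" "3 * k \<le> n"
  shows "coef alpha dt k i n l = dt powr alpha / Gamma (1 - alpha) *
    kernel_sum dt k i l (\<lambda>\<xi>. (tnode dt (int n) - \<xi>) powr (- alpha))"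
proof -
  have "(\<Sum>j=1..n. piece_integral alpha dt k i l n j) = (\<Sum>j=1..2*k. piece_integral alpha dt k i l n j)"
  proof (rule sum.mono_neutral_right)
    show "\<forall>j\<in>{1..n} - {1..2*k}. piece_integral alpha dt k i l n j = 0"
    proof
      fix j assume "j \<in> {1..n} - {1..2*k}"
      then have "Ppiece dt (unit_data l) k i n j = (\<lambda>_. 0)"
        using assms by (intro Ppiece_unit_data_eq_0_right) auto
      then show "piece_integral alpha dt k i l n j = 0" by simp
    qed
  qed (use assms in auto)
  also have "\<dots> = kernel_sum dt k i l (\<lambda>\<xi>. (tnode dt (int n) - \<xi>) powr (- alpha))"
    unfolding kernel_sum_def deriv_Ppiece[symmetric]
  proof (rule sum.cong[OF refl])
    fix j assume "j \<in> {1..2*k}"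
    then have "Ppiece dt (unit_data l) k i n j = Ppiece dt (unit_data l) k i (3 * k) j"
      using assms by (intro Ppiece_indep_n) auto
    then show "piece_integral alpha dt k i l n j = integral {tnode dt (int j - 1)..tnode dt (int j)}
       (\<lambda>\<xi>. (tnode dt (int n) - \<xi>) powr (- alpha) * deriv (Ppiece dt (unit_data l) k i (3 * k) j) \<xi>)"
      by simp
  qed
  finally show ?thesis unfolding coef_altdef by simp
qed

lemma kernel_sum_bound:
  assumes "0 < dt"
  obtains C where "0 \<le> C"
    "\<And>\<phi> E. (\<And>x. x \<in> {0..tnode dt (2 * int k)} \<Longrightarrow> \<bar>\<phi> x\<bar> \<le> E) \<Longrightarrow>
       continuous_on {0..tnode dt (2 * int k)} \<phi> \<Longrightarrow> 0 \<le> E \<Longrightarrow>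
       \<bar>kernel_sum dt k i l \<phi>\<bar> \<le> C * E"
proof -
  have sub: "{tnode dt (int j - 1)..tnode dt (int j)} \<subseteq> {0..tnode dt (2 * int k)}" if "j \<in> {1..2*k}" for j
  proof -
    have "0 \<le> tnode dt (int j - 1)" "tnode dt (int j) \<le> tnode dt (2 * int k)"
      using that assms by (auto simp: tnode_def)
    then show ?thesis by auto
  qed
  obtain C where C: "0 \<le> C" "\<And>\<phi> E. (\<And>j x. j \<in> {1..2*k} \<Longrightarrow> x \<in> {tnode dt (int j - 1)..tnode dt (int j)} \<Longrightarrow> \<bar>\<phi> x\<bar> \<le> E) \<Longrightarrow>
       (\<And>j. j \<in> {1..2*k} \<Longrightarrow> continuous_on {tnode dt (int j - 1)..tnode dt (int j)} \<phi>) \<Longrightarrow> 0 \<le> E \<Longrightarrow>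
       \<bar>kernel_sum dt k i l \<phi>\<bar> \<le> C * E"
    unfolding kernel_sum_def
    by (rule sum_integral_poly_bound[of "{1..2*k}" "\<lambda>j. tnode dt (int j - 1)" "\<lambda>j. tnode dt (int j)"
        "\<lambda>j. pderiv (Ppoly dt (unit_data l) k i (3 * k) j)"]) (use assms in \<open>auto simp: tnode_def\<close>)
  show ?thesis
  proof (rule that[OF C(1)])
    fix \<phi> :: "real \<Rightarrow> real" and E :: real
    assume "\<And>x. x \<in> {0..tnode dt (2 * int k)} \<Longrightarrow> \<bar>\<phi> x\<bar> \<le> E" 
       "continuous_on {0..tnode dt (2 * int k)} \<phi>" "0 \<le> E"
    then show "\<bar>kernel_sum dt k i l \<phi>\<bar> \<le> C * E"
      using sub by (intro C(2)) (blast intro: continuous_on_subset)+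
  qed
qed

lemma kernel_sum_diff:
  assumes "0 < dt" "continuous_on {0..tnode dt (2 * int k)} \<phi>" "continuous_on {0..tnode dt (2 * int k)} \<psi>"
  shows "kernel_sum dt k i l (\<lambda>x. \<phi> x - \<psi> x) = kernel_sum dt k i l \<phi> - kernel_sum dt k i l \<psi>"
  unfolding kernel_sum_def sum_subtractf[symmetric]
proof (rule sum.cong[OF refl])
  fix j assume "j \<in> {1..2*k}"
  then have "0 \<le> tnode dt (int j - 1)" "tnode dt (int j) \<le> tnode dt (2 * int k)"
    using assms by (auto simp: tnode_def)
  then have sub: "{tnode dt (int j - 1)..tnode dt (int j)} \<subseteq> {0..tnode dt (2 * int k)}" by auto
  show "integral {tnode dt (int j - 1)..tnode dt (int j)}
          (\<lambda>x. (\<phi> x - \<psi> x) * poly (pderiv (Ppoly dt (unit_data l) k i (3 * k) j)) x) =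
        integral {tnode dt (int j - 1)..tnode dt (int j)}
          (\<lambda>x. \<phi> x * poly (pderiv (Ppoly dt (unit_data l) k i (3 * k) j)) x) -
        integral {tnode dt (int j - 1)..tnode dt (int j)}
          (\<lambda>x. \<psi> x * poly (pderiv (Ppoly dt (unit_data l) k i (3 * k) j)) x)"
    unfolding left_diff_distrib
    by (intro integral_diff integrable_continuous_real continuous_intros
        continuous_on_subset[OF assms(2) sub] continuous_on_subset[OF assms(3) sub])
qed

text \<open>The piecewise interpolant of the unit data at an interior node vanishes at both ends of
  the interval, so its derivative has mean zero.\<close>
lemma kernel_sum_const:
  assumes "0 < dt" "1 \<le> i" "i \<le> k"
  shows "kernel_sum dt k i k (\<lambda>_. c) = 0"
proof -
  have "integral {tnode dt (int j - 1)..tnode dt (int j)}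
      (\<lambda>x. c * poly (pderiv (Ppoly dt (unit_data k) k i (3 * k) j)) x)
    = c * unit_data k (int j) - c * unit_data k (int j - 1)" if j: "j \<in> {1..2*k}" for j
  proof -
    let ?P = "Ppoly dt (unit_data k) k i (3 * k) j"
    have int: "((\<lambda>x. c * poly (pderiv ?P) x) has_integral
        c * poly ?P (tnode dt (int j)) - c * poly ?P (tnode dt (int j - 1))) {tnode dt (int j - 1)..tnode dt (int j)}"
      using assms(1)
      by (intro fundamental_theorem_of_calculus)
        (auto simp: tnode_def has_real_derivative_iff_has_vector_derivative[symmetric]
          intro!: DERIV_cmult DERIV_subset[OF poly_DERIV])
    obtain m q where mq: "Ppiece dt (unit_data k) k i (3 * k) j = interp dt (unit_data k) m (int j) q"
      "int j - 1 \<in> nodes m (int j) q" "int j \<in> nodes m (int j) q"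
      by (rule Ppiece_interp[OF assms(2,3), of "3 * k" j]) (use j in auto)
    have "poly ?P (tnode dt (int j)) = unit_data k (int j)"
      "poly ?P (tnode dt (int j - 1)) = unit_data k (int j - 1)"
      by (simp_all only: Ppiece_eq_poly[symmetric] mq(1) interp_node[OF assms(1) mq(2)] interp_node[OF assms(1) mq(3)])
    with int show ?thesis by (simp only: integral_unique)
  qed
  then have "kernel_sum dt k i k (\<lambda>_. c) = (\<Sum>j=1..2*k. c * unit_data k (int j) - c * unit_data k (int j - 1))"
    unfolding kernel_sum_def by (intro sum.cong) auto
  also have "\<dots> = (\<Sum>j=1..2*k. c * unit_data k (int j) - c * unit_data k (int (j - 1)))"
    by (intro sum.cong) (auto simp: of_nat_diff)
  \<comment> \<open>Telescoping leaves the unit data at the nodes 2k and 0, neither of which is k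
    because k >= 1.\<close>
  also have "\<dots> = 0"
    using sum_telescope''[of 0 "2*k" "\<lambda>j. c * unit_data k (int j)"] assms by simp
  finally show ?thesis .
qed

section \<open>Decay rates of the weights and their differences\<close>

lemma kernel_continuous:
  assumes "0 < dt" "2 * k < n"
  shows "continuous_on {0..tnode dt (2 * int k)} (\<lambda>\<xi>. (tnode dt (int n) - \<xi>) powr (- alpha))"
  using assms by (intro continuous_intros) (auto simp: tnode_def)

lemma tnode_diff_ge:
  assumes "0 < dt" "2 * k < n" "x \<in> {0..tnode dt (2 * int k)}"
  shows "tnode dt (int n - 2 * int k) \<le> tnode dt (int n) - x"
  using assms by (auto simp: tnode_def algebra_simps)

text \<open>On the first 2k intervals the kernel is at most (t_(n-2k))^(-alpha), which tends to 0,
  and the functional applied to it is bounded.\<close>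

lemma coef_tendsto_0:
  assumes "0 < alpha" "0 < dt" "1 \<le> i" "i \<le> k" "l \<le> k"
  shows "(\<lambda>n. coef alpha dt k i n l) \<longlonglongrightarrow> 0"
proof -
  define K where "K = dt powr alpha / Gamma (1 - alpha)"
  obtain C where C: "0 \<le> C"
    "\<And>\<phi> E. (\<And>x. x \<in> {0..tnode dt (2 * int k)} \<Longrightarrow> \<bar>\<phi> x\<bar> \<le> E) \<Longrightarrow>
       continuous_on {0..tnode dt (2 * int k)} \<phi> \<Longrightarrow> 0 \<le> E \<Longrightarrow> \<bar>kernel_sum dt k i l \<phi>\<bar> \<le> C * E"
    using kernel_sum_bound[OF assms(2)] by blast
  have "\<bar>coef alpha dt k i n l\<bar> \<le> \<bar>K\<bar> * (C * tnode dt (int n - 2 * int k) powr (- alpha))" if n: "3 * k \<le> n" for n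
  proof -
    have "\<bar>kernel_sum dt k i l (\<lambda>\<xi>. (tnode dt (int n) - \<xi>) powr (- alpha))\<bar>
      \<le> C * tnode dt (int n - 2 * int k) powr (- alpha)"
    proof (rule C(2))
      fix x assume "x \<in> {0..tnode dt (2 * int k)}"
      from tnode_diff_ge[OF assms(2) _ this, of n]
      show "\<bar>(tnode dt (int n) - x) powr (- alpha)\<bar> \<le> tnode dt (int n - 2 * int k) powr (- alpha)"
        using assms n by (auto simp: tnode_def intro!: powr_mono2')
    qed (use assms n in \<open>auto intro!: kernel_continuous\<close>)
    then show ?thesis
      unfolding coef_eq_kernel_sum[OF assms(3-5) n] K_def[symmetric] abs_mult by (intro mult_left_mono) auto
  qed
  then have ev: "eventually (\<lambda>n. norm (coef alpha dt k i n l) \<le> \<bar>K\<bar> * (C * tnode dt (int n - 2 * int k) powr (- alpha))) sequentially"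
    unfolding eventually_sequentially by auto
  have "filterlim (\<lambda>n. tnode dt (int n - 2 * int k)) at_top sequentially"
    unfolding tnode_def using assms(2) by real_asymp
  then have "(\<lambda>n. tnode dt (int n - 2 * int k) powr (- alpha)) \<longlonglongrightarrow> 0"
    using assms(1) by (intro tendsto_neg_powr) auto
  then have "(\<lambda>n. \<bar>K\<bar> * (C * tnode dt (int n - 2 * int k) powr (- alpha))) \<longlonglongrightarrow> 0"
    by (intro tendsto_mult_right_zero)
  then show ?thesis by (rule Lim_null_comparison[OF ev])
qed

lemma bound_from_eventual_bound:
  fixes a r :: "nat \<Rightarrow> real"
  assumes "\<And>m. M \<le> m \<Longrightarrow> \<bar>a m\<bar> \<le> C * r m" "\<And>m. 0 < r m"
  obtains C' where "0 \<le> C'" "\<And>m. \<bar>a m\<bar> \<le> C' * r m"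
proof (rule that[of "\<bar>C\<bar> + (\<Sum>m<M. \<bar>a m\<bar> / r m)"])
  have r: "0 \<le> \<bar>a m\<bar> / r m" for m using assms(2)[of m] by auto
  have S: "0 \<le> (\<Sum>m<M. \<bar>a m\<bar> / r m)" by (intro sum_nonneg r)
  then show "0 \<le> \<bar>C\<bar> + (\<Sum>m<M. \<bar>a m\<bar> / r m)" by simp
  fix m
  show "\<bar>a m\<bar> \<le> (\<bar>C\<bar> + (\<Sum>m<M. \<bar>a m\<bar> / r m)) * r m"
  proof (cases "M \<le> m")
    case True
    then have "\<bar>a m\<bar> \<le> C * r m" by (rule assms(1))
    also have "\<dots> \<le> (\<bar>C\<bar> + (\<Sum>m<M. \<bar>a m\<bar> / r m)) * r m"
      using assms(2)[of m] S by (intro mult_right_mono) auto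
    finally show ?thesis .
  next
    case False
    then have "\<bar>a m\<bar> / r m \<le> (\<Sum>m<M. \<bar>a m\<bar> / r m)" by (intro member_le_sum r) auto
    then have "\<bar>a m\<bar> / r m \<le> \<bar>C\<bar> + (\<Sum>m<M. \<bar>a m\<bar> / r m)" by simp
    then show ?thesis using assms(2)[of m] by (simp add: field_simps)
  qed
qed

lemma tnode_powr_le:
  assumes "0 < dt" "1 \<le> k" "2 * k \<le> m" "0 \<le> s"
  shows "tnode dt (int m - int k) powr (- s) \<le> (dt / 4) powr (- s) * real (Suc m) powr (- s)"
proof -
  \<comment> \<open>From m >= 2k and m >= 1 one gets m - k >= m/2 >= (m + 1)/4.\<close>
  have "real (Suc m) / 4 \<le> real_of_int (int m - int k)" using assms by simp
  then have "dt * (real (Suc m) / 4) \<le> dt * real_of_int (int m - int k)"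
    using assms by (intro mult_left_mono) auto
  then have "dt / 4 * real (Suc m) \<le> tnode dt (int m - int k)"
    by (simp add: tnode_def mult_ac)
  then have "tnode dt (int m - int k) powr (- s) \<le> (dt / 4 * real (Suc m)) powr (- s)"
    using assms by (intro powr_mono2') auto
  also have "\<dots> = (dt / 4) powr (- s) * real (Suc m) powr (- s)"
    by (rule powr_mult)
  finally show ?thesis .
qed

text \<open>The functional annihilates constants, so the value of the kernel at 0 may be subtracted;
  the resulting first difference gains one order of decay.\<close>

lemma omega_bound:
  assumes "0 < alpha" "0 < dt" "1 \<le> i" "i \<le> k"
  obtains C where "0 \<le> C" "\<And>m. \<bar>omega alpha dt k i m\<bar> \<le> C * real (Suc m) powr (- (1 + alpha))"
proof -
  define K where "K = dt powr alpha / Gamma (1 - alpha)"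
  obtain C where C: "0 \<le> C"
    "\<And>\<phi> E. (\<And>x. x \<in> {0..tnode dt (2 * int k)} \<Longrightarrow> \<bar>\<phi> x\<bar> \<le> E) \<Longrightarrow>
       continuous_on {0..tnode dt (2 * int k)} \<phi> \<Longrightarrow> 0 \<le> E \<Longrightarrow> \<bar>kernel_sum dt k i k \<phi>\<bar> \<le> C * E"
    using kernel_sum_bound[OF assms(2)] by blast
  define T where "T = tnode dt (2 * int k)"
  have T: "0 \<le> T" using assms by (simp add: T_def tnode_def)
  have "\<bar>omega alpha dt k i m\<bar> \<le> \<bar>K\<bar> * (C * (alpha * (dt / 4) powr (- (1 + alpha)) * T)) * real (Suc m) powr (- (1 + alpha))"
    if m: "2 * k \<le> m" for m
  proof -
    define t where "t = tnode dt (int (m + k))"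
    \<comment> \<open>With n = m + k this is t_(n-2k), the least distance from t_n to the first 2k
      intervals.\<close>
    define c where "c = tnode dt (int m - int k)"
    have c: "0 < c" using assms m by (auto simp: c_def tnode_def)
    have low: "c \<le> t - x" if "x \<in> {0..T}" for x
      using tnode_diff_ge[OF assms(2), of k "m + k" x] that m assms by (simp add: T_def t_def c_def)
    have cont: "continuous_on {0..T} (\<lambda>x. (t - x) powr (- alpha))"
      unfolding t_def T_def using assms m by (intro kernel_continuous) auto
    have "omega alpha dt k i m = K * kernel_sum dt k i k (\<lambda>x. (t - x) powr (- alpha))"
      unfolding omega_def K_def t_def using assms m by (intro coef_eq_kernel_sum) auto
    also have "kernel_sum dt k i k (\<lambda>x. (t - x) powr (- alpha)) =
        kernel_sum dt k i k (\<lambda>x. (t - x) powr (- alpha) - t powr (- alpha))"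
      using kernel_sum_diff[OF assms(2) cont[unfolded T_def] continuous_on_const] kernel_sum_const[OF assms(2-4)] by simp
    finally have om: "omega alpha dt k i m = K * \<dots>" .
    have "\<bar>kernel_sum dt k i k (\<lambda>x. (t - x) powr (- alpha) - t powr (- alpha))\<bar>
        \<le> C * (alpha * c powr (- alpha - 1) * T)"
    proof (rule C(2))
      fix x assume x: "x \<in> {0..tnode dt (2 * int k)}"
      have "\<bar>(t - x) powr (- alpha) - t powr (- alpha)\<bar> \<le> alpha * c powr (- alpha - 1) * \<bar>(t - x) - t\<bar>"
        using assms c low[of x] low[of 0] x T by (intro powr_minus_diff_bound) (auto simp: T_def)
      also have "\<dots> \<le> alpha * c powr (- alpha - 1) * T"
        using x assms by (intro mult_left_mono) (auto simp: T_def)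
      finally show "\<bar>(t - x) powr (- alpha) - t powr (- alpha)\<bar> \<le> alpha * c powr (- alpha - 1) * T" .
    qed (use cont assms T in \<open>auto simp: T_def intro!: continuous_intros\<close>)
    also have "c powr (- alpha - 1) = c powr (- (1 + alpha))" by (rule arg_cong[of _ _ "(powr) c"]) simp
    also have "C * (alpha * c powr (- (1 + alpha)) * T)
      \<le> C * (alpha * ((dt / 4) powr (- (1 + alpha)) * real (Suc m) powr (- (1 + alpha))) * T)"
      unfolding c_def using assms m T C(1) by (intro mult_left_mono mult_right_mono tnode_powr_le) auto
    finally have "\<bar>K\<bar> * \<bar>kernel_sum dt k i k (\<lambda>x. (t - x) powr (- alpha) - t powr (- alpha))\<bar>
      \<le> \<bar>K\<bar> * (C * (alpha * ((dt / 4) powr (- (1 + alpha)) * real (Suc m) powr (- (1 + alpha))) * T))"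
      by (intro mult_left_mono) auto
    then show ?thesis unfolding om abs_mult by (simp only: mult_ac)
  qed
  then show ?thesis
    by (rule bound_from_eventual_bound[of "2 * k" "omega alpha dt k i"]) (auto intro: that)
qed

text \<open>Increasing m by one moves the kernel by one time step, so the difference of weights is
  the functional applied to the kernel difference \<open>H\<close>. Subtracting a constant again
  gives a second difference, gaining two orders.\<close>

lemma omega_diff_bound:
  assumes "0 < alpha" "0 < dt" "1 \<le> i" "i \<le> k"
  obtains C where "0 \<le> C"
    "\<And>m. \<bar>omega alpha dt k i (Suc m) - omega alpha dt k i m\<bar> \<le> C * real (Suc m) powr (- (2 + alpha))"
proof -
  define K where "K = dt powr alpha / Gamma (1 - alpha)"
  obtain C where C: "0 \<le> C"
    "\<And>\<phi> E. (\<And>x. x \<in> {0..tnode dt (2 * int k)} \<Longrightarrow> \<bar>\<phi> x\<bar> \<le> E) \<Longrightarrow>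
       continuous_on {0..tnode dt (2 * int k)} \<phi> \<Longrightarrow> 0 \<le> E \<Longrightarrow> \<bar>kernel_sum dt k i k \<phi>\<bar> \<le> C * E"
    using kernel_sum_bound[OF assms(2)] by blast
  define T where "T = tnode dt (2 * int k)"
  have T: "0 \<le> T" using assms by (simp add: T_def tnode_def)
  have "\<bar>omega alpha dt k i (Suc m) - omega alpha dt k i m\<bar>
      \<le> \<bar>K\<bar> * (C * (alpha * ((alpha + 1) * (dt / 4) powr (- (2 + alpha)) * dt) * T)) * real (Suc m) powr (- (2 + alpha))"
    if m: "2 * k \<le> m" for m
  proof -
    define t where "t = tnode dt (int (m + k))"
    define c where "c = tnode dt (int m - int k)"
    define H where "H = (\<lambda>s. (s + dt) powr (- alpha) - s powr (- alpha))"
    have c: "0 < c" using assms m by (auto simp: c_def tnode_def)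
    have t': "tnode dt (int (Suc m + k)) = t + dt" by (simp add: t_def tnode_def algebra_simps)
    have low: "c \<le> t - x" if "x \<in> {0..T}" for x
      using tnode_diff_ge[OF assms(2), of k "m + k" x] that m assms by (simp add: T_def t_def c_def)
    have cont: "continuous_on {0..T} (\<lambda>x. (t - x) powr (- alpha))"
      unfolding t_def T_def using assms m by (intro kernel_continuous) auto
    have cont': "continuous_on {0..T} (\<lambda>x. (t + dt - x) powr (- alpha))"
      unfolding t'[symmetric] T_def using assms m by (intro kernel_continuous) auto
    have Heq: "H (t - x) = (t + dt - x) powr (- alpha) - (t - x) powr (- alpha)" for x
      by (simp add: H_def algebra_simps)
    have contH: "continuous_on {0..T} (\<lambda>x. H (t - x))"
      unfolding Heq by (intro continuous_on_diff cont cont')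
    have om0: "omega alpha dt k i m = K * kernel_sum dt k i k (\<lambda>x. (t - x) powr (- alpha))"
      unfolding omega_def K_def t_def using assms m by (intro coef_eq_kernel_sum) auto
    have om1: "omega alpha dt k i (Suc m) = K * kernel_sum dt k i k (\<lambda>x. (t + dt - x) powr (- alpha))"
      unfolding omega_def K_def t'[symmetric] using assms m by (intro coef_eq_kernel_sum) auto
    have "kernel_sum dt k i k (\<lambda>x. H (t - x) - H t) = kernel_sum dt k i k (\<lambda>x. H (t - x))"
      using kernel_sum_diff[OF assms(2) contH[unfolded T_def] continuous_on_const] kernel_sum_const[OF assms(2-4)] by simp
    also have "\<dots> = kernel_sum dt k i k (\<lambda>x. (t + dt - x) powr (- alpha)) - kernel_sum dt k i k (\<lambda>x. (t - x) powr (- alpha))"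
      unfolding Heq by (rule kernel_sum_diff[OF assms(2) cont'[unfolded T_def] cont[unfolded T_def]])
    finally have om: "omega alpha dt k i (Suc m) - omega alpha dt k i m = K * kernel_sum dt k i k (\<lambda>x. H (t - x) - H t)"
      unfolding om0 om1 by (simp add: right_diff_distrib)
    have "\<bar>kernel_sum dt k i k (\<lambda>x. H (t - x) - H t)\<bar>
        \<le> C * (alpha * ((alpha + 1) * c powr (- alpha - 2) * dt) * T)"
    proof (rule C(2))
      fix x assume x: "x \<in> {0..tnode dt (2 * int k)}"
      have "\<bar>H (t - x) - H t\<bar> \<le> alpha * ((alpha + 1) * c powr (- alpha - 2) * dt) * \<bar>(t - x) - t\<bar>"
        unfolding H_def
        using assms c low[of x] low[of 0] x T by (intro powr_minus_second_diff_bound) (auto simp: T_def)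
      also have "\<dots> \<le> alpha * ((alpha + 1) * c powr (- alpha - 2) * dt) * T"
        using x assms by (intro mult_left_mono) (auto simp: T_def)
      finally show "\<bar>H (t - x) - H t\<bar> \<le> alpha * ((alpha + 1) * c powr (- alpha - 2) * dt) * T" .
    qed (use contH assms T in \<open>auto simp: T_def intro!: continuous_intros\<close>)
    also have "c powr (- alpha - 2) = c powr (- (2 + alpha))" by (rule arg_cong[of _ _ "(powr) c"]) simp
    also have "C * (alpha * ((alpha + 1) * c powr (- (2 + alpha)) * dt) * T)
      \<le> C * (alpha * ((alpha + 1) * ((dt / 4) powr (- (2 + alpha)) * real (Suc m) powr (- (2 + alpha))) * dt) * T)"
      unfolding c_def using assms m T C(1) by (intro mult_left_mono mult_right_mono tnode_powr_le) auto
    finally have "\<bar>K\<bar> * \<bar>kernel_sum dt k i k (\<lambda>x. H (t - x) - H t)\<bar>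
      \<le> \<bar>K\<bar> * (C * (alpha * ((alpha + 1) * ((dt / 4) powr (- (2 + alpha)) * real (Suc m) powr (- (2 + alpha))) * dt) * T))"
      by (intro mult_left_mono) auto
    then show ?thesis unfolding om abs_mult by (simp only: mult_ac)
  qed
  then show ?thesis
    by (rule bound_from_eventual_bound[of "2 * k" "\<lambda>m. omega alpha dt k i (Suc m) - omega alpha dt k i m"])
      (auto intro: that)
qed

lemma summable_Suc_powr:
  fixes s :: real
  assumes "1 < s"
  shows "summable (\<lambda>m. real (Suc m) powr (- s))"
  using assms by (subst summable_Suc_iff) (simp add: summable_real_powr_iff)

lemma summable_omega:
  assumes "0 < alpha" "0 < dt" "1 \<le> i" "i \<le> k"
  shows "summable (\<lambda>m. \<bar>omega alpha dt k i m\<bar>)"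
proof -
  obtain C where "\<And>m. \<bar>omega alpha dt k i m\<bar> \<le> C * real (Suc m) powr (- (1 + alpha))"
    using omega_bound[OF assms] by blast
  then show ?thesis
    using assms(1) by (intro summable_comparison_test'[OF summable_mult[OF summable_Suc_powr[of "1 + alpha"]]]) auto
qed

text \<open>The weights at level n + k sum to 0. Those with l >= k form a partial sum of the series,
  and the k others tend to 0.\<close>

lemma sum_omega_eq_0:
  assumes "0 < alpha" "alpha < 1" "0 < dt" "1 \<le> i" "i \<le> k"
  shows "(\<Sum>m. omega alpha dt k i m) = 0"
proof -
  have sm: "summable (omega alpha dt k i)"
    using summable_omega[OF assms(1,3-5)] by (rule summable_rabs_cancel)
  have eq: "(\<Sum>m<Suc n. omega alpha dt k i m) = - (\<Sum>l<k. coef alpha dt k i (n + k) l)" for n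
  proof -
    have "0 = (\<Sum>l<Suc (n + k). coef alpha dt k i (n + k) l)"
      using sum_coef_eq_0[OF assms(2-5), of "n + k"] by (simp add: lessThan_Suc_atMost)
    also have "{..<Suc (n + k)} = {..<k} \<union> {k..<Suc n + k}" by auto
    also have "(\<Sum>l\<in>\<dots>. coef alpha dt k i (n + k) l) =
       (\<Sum>l<k. coef alpha dt k i (n + k) l) + (\<Sum>l\<in>{k..<Suc n + k}. coef alpha dt k i (n + k) l)"
      by (rule sum.union_disjoint) auto
    also have "(\<Sum>l\<in>{k..<Suc n + k}. coef alpha dt k i (n + k) l) = (\<Sum>l\<in>{k..<Suc n + k}. omega alpha dt k i (n + k - l))"
      using assms by (intro sum.cong coef_eq_omega) auto
    also have "\<dots> = (\<Sum>m<Suc n. omega alpha dt k i m)"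
      by (rule sum.reindex_bij_witness[of _ "\<lambda>m. n + k - m" "\<lambda>l. n + k - l"]) auto
    finally show ?thesis by simp
  qed
  have "(\<lambda>n. - (\<Sum>l<k. coef alpha dt k i (n + k) l)) \<longlonglongrightarrow> - (\<Sum>l<k. 0)"
    using assms by (intro tendsto_intros LIMSEQ_ignore_initial_segment coef_tendsto_0) auto
  then have "(\<lambda>n. \<Sum>m<Suc n. omega alpha dt k i m) \<longlonglongrightarrow> 0" unfolding eq by simp
  then have "(\<lambda>n. \<Sum>m<n. omega alpha dt k i m) \<longlonglongrightarrow> 0" by (rule LIMSEQ_imp_Suc)
  then show ?thesis using summable_LIMSEQ[OF sm] LIMSEQ_unique by blast
qed

section \<open>The stability region\<close>

text \<open>The quotient is q_n = sum over m of F_(n+1+m) x^m, built from the tails of F, which stay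
  controlled for |x| <= 1. Comparing coefficients works by splitting off the head of the tail; the
  root enters only at the constant term.\<close>

lemma l1_linear_factor:
  fixes F :: "complex fps"
  assumes "0 < alpha" "0 \<le> C" "cmod x \<le> 1"
    and bound: "\<And>m. cmod (fps_nth F (Suc m)) \<le> C * real (Suc m) powr (- (2 + alpha))"
    and root: "(\<lambda>n. fps_nth F n * x ^ n) sums 0"
  obtains q where "F = (fps_X - fps_const x) * q" "summable (\<lambda>n. cmod (fps_nth q n))"
proof -
  \<comment> \<open>Since 2 s = 2 + alpha, the decay in m + n can be shared equally between m and n,
    and s > 1 makes both resulting series converge.\<close>
  define s where "s = 1 + alpha / 2"
  define S where "S = (\<Sum>m. real (Suc m) powr (- s))"
  have smS: "summable (\<lambda>m. real (Suc m) powr (- s))"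
    using assms(1) by (intro summable_Suc_powr) (simp add: s_def)
  have term_le: "cmod (fps_nth F (m + Suc n) * x ^ m) \<le> C * real (Suc n) powr (- s) * real (Suc m) powr (- s)" for m n
  proof -
    have "cmod x ^ m \<le> 1" using assms by (intro power_le_one) auto
    then have "cmod (fps_nth F (m + Suc n) * x ^ m) \<le> cmod (fps_nth F (Suc (m + n)))"
      using mult_left_mono[of "cmod x ^ m" 1 "cmod (fps_nth F (Suc (m + n)))"] by (simp add: norm_mult norm_power)
    also have "\<dots> \<le> C * real (Suc (m + n)) powr (- (2 + alpha))" by (rule bound)
    also have "- (2 + alpha) = - s + - s" by (simp add: s_def)
    also have "real (Suc (m + n)) powr (- s + - s) = real (Suc (m + n)) powr (- s) * real (Suc (m + n)) powr (- s)"
      by (rule powr_add)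
    also have "\<dots> \<le> real (Suc n) powr (- s) * real (Suc m) powr (- s)"
      using assms(1) by (intro mult_mono powr_mono2') (auto simp: s_def)
    finally show ?thesis using assms(2) by (simp add: mult_left_mono mult.assoc)
  qed
  have smq: "summable (\<lambda>m. fps_nth F (m + Suc n) * x ^ m)" for n
    by (rule summable_comparison_test'[OF summable_mult[OF smS] term_le])
  define q where "q = Abs_fps (\<lambda>n. \<Sum>m. fps_nth F (m + Suc n) * x ^ m)"
  have "cmod (fps_nth q n) \<le> C * real (Suc n) powr (- s) * S" for n
    unfolding q_def fps_nth_Abs_fps S_def
    by (subst suminf_mult[OF smS, symmetric]) (rule norm_suminf_le[OF term_le summable_mult[OF smS]])
  then have "summable (\<lambda>n. cmod (fps_nth q n))"
    by (intro summable_comparison_test'[OF summable_mult2[OF summable_mult[OF smS]]]) auto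
  moreover have "fps_nth F n = fps_nth ((fps_X - fps_const x) * q) n" for n
  proof (cases n)
    case 0
    have "(\<lambda>m. fps_nth F (Suc m) * x ^ Suc m) sums (- fps_nth F 0)"
      using root sums_Suc_iff[of "\<lambda>n. fps_nth F n * x ^ n" "- fps_nth F 0"] by simp
    moreover have "(\<lambda>m. x * (fps_nth F (m + Suc 0) * x ^ m)) sums (x * fps_nth q 0)"
      unfolding q_def fps_nth_Abs_fps by (intro sums_mult summable_sums smq)
    ultimately have "x * fps_nth q 0 = - fps_nth F 0"
      by (intro sums_unique2[of _ "x * fps_nth q 0" "- fps_nth F 0"]) (simp_all add: mult_ac)
    then show ?thesis using 0 by (simp add: left_diff_distrib)
  next
    case (Suc n')
    have "(\<Sum>m. fps_nth F (m + Suc n') * x ^ m)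
        = (\<Sum>m. fps_nth F (Suc m + Suc n') * x ^ Suc m) + fps_nth F (0 + Suc n') * x ^ 0"
      using suminf_split_head[OF smq[of n']] by simp
    also have "(\<Sum>m. fps_nth F (Suc m + Suc n') * x ^ Suc m) = (\<Sum>m. x * (fps_nth F (m + Suc n) * x ^ m))"
      by (simp add: Suc mult_ac)
    also have "\<dots> = x * fps_nth q n"
      unfolding q_def fps_nth_Abs_fps by (rule suminf_mult[OF smq])
    finally have "fps_nth q n' = x * fps_nth q n + fps_nth F n" by (simp add: q_def Suc)
    then show ?thesis using Suc by (simp add: left_diff_distrib)
  qed
  ultimately show ?thesis by (intro that[of q]) (auto intro: fps_ext)
qed

text \<open>Beyond index k the equation reads p_n = x p_(n+1), so |p_n| cannot decrease there; being
  null, p vanishes from k + 1 on. The equations at k and k - 1 then give p_k = -z and -x p_k =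
  z.\<close>

lemma c0_solution_at_disc_point:
  fixes q Y :: "complex fps"
  assumes "summable (\<lambda>n. cmod (fps_nth q n))" "fps_nth Y \<longlonglongrightarrow> 0" "cmod x \<le> 1" "1 \<le> k"
    and Y0: "\<And>j. j < k \<Longrightarrow> fps_nth Y j = 0"
    and eq: "(fps_X - fps_const x) * q * Y = fps_const z * (1 - fps_X) * fps_X ^ k"
  shows "z * (1 - x) = 0"
proof -
  define p where "p = q * Y"
  have p: "fps_nth p \<longlonglongrightarrow> 0" unfolding p_def by (rule l1_mult_c0[OF assms(1,2)])
  have p0: "fps_nth p j = 0" if "j < k" for j
    unfolding p_def fps_mult_nth using that by (intro sum.neutral) (auto simp: Y0)
  have eq': "(fps_X - fps_const x) * p = fps_const z * (fps_X ^ k - fps_X ^ Suc k)"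
    using eq by (simp add: p_def algebra_simps)
  have rec: "fps_nth p n - x * fps_nth p (Suc n) = z * ((if Suc n = k then 1 else 0) - (if n = k then 1 else 0))" for n
    using arg_cong[OF eq', of "\<lambda>g. fps_nth g (Suc n)"]
    by (simp add: left_diff_distrib fps_X_power_nth del: power_Suc)
  have "cmod (fps_nth p (Suc k)) \<le> cmod (fps_nth p (m + Suc k))" for m
  proof (induction m)
    case (Suc m)
    have "fps_nth p (m + Suc k) = x * fps_nth p (Suc m + Suc k)" using rec[of "m + Suc k"] by simp
    then have "cmod (fps_nth p (m + Suc k)) \<le> cmod (fps_nth p (Suc m + Suc k))"
      using assms(3) by (simp add: norm_mult mult_left_le_one_le)
    then show ?case using Suc by linarith
  qed simp
  moreover have "(\<lambda>m. cmod (fps_nth p (m + Suc k))) \<longlonglongrightarrow> 0"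
    using LIMSEQ_ignore_initial_segment[OF p, of "Suc k"] by (rule tendsto_norm_zero)
  ultimately have "cmod (fps_nth p (Suc k)) \<le> 0" by (intro LIMSEQ_le_const) auto
  then have "fps_nth p k = - z" using rec[of k] by simp
  moreover have "- (x * fps_nth p k) = z" using rec[of "k - 1"] p0[of "k - 1"] \<open>1 \<le> k\<close> by simp
  ultimately show ?thesis by (simp add: algebra_simps)
qed

section \<open>The symbol of the recursion\<close>

definition symbol :: "real \<Rightarrow> real \<Rightarrow> nat \<Rightarrow> nat \<Rightarrow> complex \<Rightarrow> complex fps" where
  "symbol alpha dt k i z = Abs_fps (\<lambda>m. complex_of_real (omega alpha dt k i m)) - fps_const z"

lemma symbol_nth:
  "fps_nth (symbol alpha dt k i z) m = complex_of_real (omega alpha dt k i m) - (if m = 0 then z else 0)"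
  by (simp add: symbol_def)

lemma symbol_mult_nth:
  "fps_nth (symbol alpha dt k i z * Abs_fps u) n
    = (\<Sum>j\<le>n. complex_of_real (omega alpha dt k i (n - j)) * u j) - z * u n"
proof -
  have "Abs_fps (\<lambda>m. complex_of_real (omega alpha dt k i m)) * Abs_fps u
     = Abs_fps u * Abs_fps (\<lambda>m. complex_of_real (omega alpha dt k i m))" by (rule mult.commute)
  then show ?thesis
    unfolding symbol_def left_diff_distrib fps_sub_nth fps_mult_left_const_nth
    by (simp add: fps_mult_nth atLeast0AtMost mult.commute)
qed

lemma recursion_iff_symbol:
  "recursion alpha dt k i z u \<longleftrightarrow>
    (\<forall>n\<ge>k. fps_nth (symbol alpha dt k i z * Abs_fps u) n = - (\<Sum>j<k. complex_of_real (wcoef alpha dt k i n j) * u j))"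
  unfolding recursion_def symbol_mult_nth by (simp add: algebra_simps eq_neg_iff_add_eq_0)

lemma summable_symbol:
  assumes "0 < alpha" "0 < dt" "1 \<le> i" "i \<le> k"
  shows "summable (\<lambda>m. cmod (fps_nth (symbol alpha dt k i z) m))"
proof -
  have "summable (\<lambda>m. \<bar>omega alpha dt k i m\<bar> + (if m = 0 then cmod z else 0))"
    using summable_omega[OF assms] by (intro summable_add) auto
  then show ?thesis
  proof (rule summable_comparison_test')
    show "norm (cmod (fps_nth (symbol alpha dt k i z) m)) \<le> \<bar>omega alpha dt k i m\<bar> + (if m = 0 then cmod z else 0)" for m
      using norm_triangle_ineq4[of "complex_of_real (omega alpha dt k i m)" "if m = 0 then z else 0"]
      by (simp add: symbol_nth split: if_splits)
  qed
qed

lemma symbol_sums: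
  assumes "0 < alpha" "0 < dt" "1 \<le> i" "i \<le> k" "cmod x \<le> 1"
  shows "(\<lambda>m. fps_nth (symbol alpha dt k i z) m * x ^ m) sums
    ((\<Sum>m. complex_of_real (omega alpha dt k i m) * x ^ m) - z)"
proof -
  have "summable (\<lambda>m. complex_of_real (omega alpha dt k i m) * x ^ m)"
    using summable_omega[OF assms(1-4)] assms(5)
    by (intro summable_norm_cancel[OF summable_power_series_closed_disc]) auto
  moreover have "(\<lambda>m. (if m = 0 then z else 0) * x ^ m) sums z"
    using sums_finite[of "{0}" "\<lambda>m. (if m = 0 then z else 0) * x ^ m"] by simp
  ultimately show ?thesis
    unfolding symbol_nth left_diff_distrib by (intro sums_diff summable_sums)
qed

lemma wcoef_tendsto_0:
  assumes "0 < alpha" "0 < dt" "1 \<le> i" "i \<le> k" "j < k"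
  shows "(\<lambda>n. wcoef alpha dt k i n j) \<longlonglongrightarrow> 0"
proof -
  have "omega alpha dt k i \<longlonglongrightarrow> 0"
    using summable_omega[OF assms(1-4)] by (rule summable_rabs_cancel[THEN summable_LIMSEQ_zero])
  then have "(\<lambda>n. omega alpha dt k i (n - j)) \<longlonglongrightarrow> 0" 
    using LIMSEQ_offset[of "\<lambda>n. omega alpha dt k i (n - j)" j 0] by simp
  then show ?thesis
    unfolding wcoef_def using tendsto_diff[OF coef_tendsto_0[OF assms(1-4), of j]] assms(5) by fastforce
qed

section \<open>Points off the image of the closed disc are stable\<close>

lemma mem_stab_region:
  assumes "0 < alpha" "0 < dt" "1 \<le> i" "i \<le> k"
    and z: "\<And>x. cmod x \<le> 1 \<Longrightarrow> z \<noteq> (\<Sum>m. complex_of_real (omega alpha dt k i m) * x ^ m)"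
  shows "z \<in> stab_region alpha dt k i"
proof -
  define f where "f = symbol alpha dt k i z"
  have ev: "(\<Sum>m. fps_nth f m * x ^ m) \<noteq> 0" if "cmod x \<le> 1" for x
    unfolding f_def sums_unique[OF symbol_sums[OF assms(1-4) that, of z], symmetric] using z[OF that] by simp
  have inv: "summable (\<lambda>n. cmod (fps_nth (inverse f) n))"
    using summable_symbol[OF assms(1-4)] ev unfolding f_def by (rule wiener_closed_disc)
  have "fps_nth f 0 \<noteq> 0" using ev[of 0] by simp
  then have invf: "inverse f * f = 1" by (rule inverse_mult_eq_1)
  show ?thesis
    unfolding stab_region_def
  proof (intro CollectI allI)
    fix s :: "nat \<Rightarrow> complex"
    \<comment> \<open>Below k the right-hand side is set to what the starting values produce, so the
      single equation f U = G encodes both the starting conditions and the recursion.\<close>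
    define G where "G = Abs_fps (\<lambda>n. if n < k then fps_nth (f * Abs_fps s) n
       else - (\<Sum>j<k. complex_of_real (wcoef alpha dt k i n j) * s j))"
    define u where "u = fps_nth (inverse f * G)"
    have agree: "fps_nth (f * Abs_fps v) n = fps_nth (f * Abs_fps s) n" if "\<forall>j<k. v j = s j" "n < k" for v n
      unfolding fps_mult_nth using that by (intro sum.cong) auto
    have iff: "(\<forall>j<k. v j = s j) \<and> recursion alpha dt k i z v \<longleftrightarrow> v = u" for v
    proof
      assume v: "(\<forall>j<k. v j = s j) \<and> recursion alpha dt k i z v"
      have "f * Abs_fps v = G"
      proof (rule fps_ext)
        fix n
        show "fps_nth (f * Abs_fps v) n = fps_nth G n"
          using v agree[of v n] unfolding recursion_iff_symbol f_def[symmetric]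
          by (cases "n < k") (auto simp: G_def)
      qed
      then have "inverse f * G = Abs_fps v" using invf by (metis mult.assoc mult_1)
      then show "v = u" by (simp add: u_def fun_eq_iff)
    next
      assume vu: "v = u"
      have fu: "f * Abs_fps u = G"
        unfolding u_def fps_nth_inverse using invf by (simp add: mult.assoc[symmetric] mult.commute[of f])
      have us: "\<forall>j<k. u j = s j"
      proof (intro allI impI)
        fix j assume j: "j < k"
        \<comment> \<open>Multiplication by f and by its inverse is lower triangular: agreement of f
          U with f S below k, where S is the series of s, gives agreement of u with s below
          k.\<close>
        define d where "d = Abs_fps u - Abs_fps s"
        have "fps_nth (f * d) n = 0" if "n < k" for n
          using that by (simp add: d_def right_diff_distrib fu) (simp add: G_def)
        then have "fps_nth (inverse f * (f * d)) j = 0"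
          unfolding fps_mult_nth[of "inverse f"] using j by (intro sum.neutral) auto
        then show "u j = s j" using invf by (simp add: mult.assoc[symmetric] d_def)
      qed
      moreover have "recursion alpha dt k i z u"
        unfolding recursion_iff_symbol f_def[symmetric] fu using us by (auto simp: G_def)
      ultimately show "(\<forall>j<k. v j = s j) \<and> recursion alpha dt k i z v" using vu by simp
    qed
    have "(\<lambda>n. - (\<Sum>j<k. complex_of_real (wcoef alpha dt k i n j) * s j)) \<longlonglongrightarrow> - (\<Sum>j<k. complex_of_real 0 * s j)"
      by (intro tendsto_intros wcoef_tendsto_0[OF assms(1-4)]) auto
    then have "(\<lambda>n. - (\<Sum>j<k. complex_of_real (wcoef alpha dt k i n j) * s j)) \<longlonglongrightarrow> 0" by simp
    moreover have "eventually (\<lambda>n. - (\<Sum>j<k. complex_of_real (wcoef alpha dt k i n j) * s j) = fps_nth G n) sequentially"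
      using eventually_ge_at_top[of k] by eventually_elim (simp add: G_def)
    ultimately have "fps_nth G \<longlonglongrightarrow> 0" by (rule Lim_transform_eventually)
    then have "u \<longlonglongrightarrow> 0" unfolding u_def by (rule l1_mult_c0[OF inv])
    then show "(\<exists>!u. (\<forall>j<k. u j = s j) \<and> recursion alpha dt k i z u) \<and>
      (\<forall>u. (\<forall>j<k. u j = s j) \<and> recursion alpha dt k i z u \<longrightarrow> u \<longlonglongrightarrow> 0)"
      unfolding iff by auto
  qed
qed

text \<open>Annihilation of constants in the shape in which the recursion uses the weights.\<close>

lemma sum_wcoef_omega_eq_0:
  assumes "alpha < 1" "0 < dt" "1 \<le> i" "i \<le> k" "k \<le> n"
  shows "(\<Sum>j<k. wcoef alpha dt k i n j) + (\<Sum>j\<le>n. omega alpha dt k i (n - j)) = 0"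
proof -
  have "(\<Sum>j\<le>n. coef alpha dt k i n j) = (\<Sum>j\<le>n. (if j < k then wcoef alpha dt k i n j else 0) + omega alpha dt k i (n - j))"
    using assms by (intro sum.cong) (auto simp: wcoef_def coef_eq_omega)
  also have "\<dots> = (\<Sum>j\<le>n. if j < k then wcoef alpha dt k i n j else 0) + (\<Sum>j\<le>n. omega alpha dt k i (n - j))"
    by (rule sum.distrib)
  also have "(\<Sum>j\<le>n. if j < k then wcoef alpha dt k i n j else 0) = (\<Sum>j<k. wcoef alpha dt k i n j)"
    using assms by (intro sum.mono_neutral_cong_right) auto
  finally show ?thesis using sum_coef_eq_0[OF assms] by simp
qed

section \<open>Points of the image are unstable\<close>

lemma not_mem_stab_region:
  assumes "0 < alpha" "alpha < 1" "0 < dt" "1 \<le> i" "i \<le> k" "cmod x \<le> 1"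
    and z: "z = (\<Sum>m. complex_of_real (omega alpha dt k i m) * x ^ m)"
  shows "z \<notin> stab_region alpha dt k i"
proof
  assume "z \<in> stab_region alpha dt k i"
  \<comment> \<open>Starting values 1 allow comparison with the constant sequence, so that u - 1
    vanishes below k.\<close>
  from this[unfolded stab_region_def, THEN CollectD, rule_format, of "\<lambda>_. 1"] obtain u where ex: "\<forall>j<k. u j = 1" "recursion alpha dt k i z u"
    and lim: "\<And>v. (\<forall>j<k. v j = 1) \<Longrightarrow> recursion alpha dt k i z v \<Longrightarrow> v \<longlonglongrightarrow> 0"
    by metis
  have wo: "(\<Sum>j\<le>n. complex_of_real (omega alpha dt k i (n - j))) = - (\<Sum>j<k. complex_of_real (wcoef alpha dt k i n j))"
    if "k \<le> n" for n
    using arg_cong[OF sum_wcoef_omega_eq_0[OF assms(2-5) that], of complex_of_real]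
    by (simp add: add_eq_0_iff)
  have "z \<noteq> 0"
  proof
    assume "z = 0"
    then have "recursion alpha dt k i z (\<lambda>_. 1)" unfolding recursion_def using wo by simp
    then have "(\<lambda>_. 1 :: complex) \<longlonglongrightarrow> 0" by (intro lim) auto
    then show False using LIMSEQ_unique[OF tendsto_const] by fastforce
  qed
  have "x \<noteq> 1"
  proof
    assume "x = 1"
    then have "z = complex_of_real (\<Sum>m. omega alpha dt k i m)"
      using summable_omega[OF assms(1,3-5)] z by (simp add: suminf_of_real summable_rabs_cancel)
    then show False using sum_omega_eq_0[OF assms(1-5)] \<open>z \<noteq> 0\<close> by simp
  qed
  define f where "f = symbol alpha dt k i z"
  define V where "V = Abs_fps (\<lambda>n. u n - 1)"
  \<comment> \<open>If u is null, the coefficients of V tend to -1; multiplying by 1 - X replaces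
    them by increments of u, which are null. The second factor 1 - X, in \<open>F\<close>, improves
    the decay of the symbol so that X - x can be divided out.\<close>
  define Y where "Y = (1 - fps_X) * V"
  define F where "F = (1 - fps_X) * f"
  \<comment> \<open>For n >= k the equations for u and for the constant 1 share the starting terms.
    Subtracting them leaves the convolution of the weights with u - 1 equal to z u_n, and z (u_n -
    1) is taken away from that.\<close>
  have fV: "fps_nth (f * V) n = (if n < k then 0 else z)" for n
  proof (cases "n < k")
    case True
    then show ?thesis using ex(1) by (auto simp: fps_mult_nth V_def intro!: sum.neutral)
  next
    case False
    then have "(\<Sum>j<k. complex_of_real (wcoef alpha dt k i n j) * u j) = (\<Sum>j<k. complex_of_real (wcoef alpha dt k i n j))"
      using ex(1) by (intro sum.cong) auto
    moreover have "(\<Sum>j<k. complex_of_real (wcoef alpha dt k i n j) * u j)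
            + (\<Sum>j\<le>n. complex_of_real (omega alpha dt k i (n - j)) * u j) = z * u n"
      using ex(2) False by (auto simp: recursion_def)
    ultimately show ?thesis
      using False wo[of n] unfolding f_def V_def symbol_mult_nth
      by (simp add: right_diff_distrib sum_subtractf algebra_simps)
  qed
  have Xk: "(1 - fps_X) * (f * V) = fps_const z * fps_X ^ k"
    by (rule fps_ext) (use assms(4,5) in \<open>auto simp: left_diff_distrib fV fps_X_power_nth\<close>)
  have "(\<lambda>m. fps_nth f m * x ^ m) sums 0"
    using symbol_sums[OF assms(1,3-6), of z] by (simp add: f_def z[symmetric])
  note f_sums = this
  have "(\<lambda>m. fps_nth F m * x ^ m) sums (0 - x * 0)"
  proof -
    have "(\<lambda>m. fps_nth (fps_X * f) (Suc m) * x ^ Suc m) sums (x * 0)"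
      using sums_mult[OF f_sums, of x] by (simp add: mult_ac)
    then have "(\<lambda>m. fps_nth (fps_X * f) m * x ^ m) sums (x * 0)"
      using sums_Suc_iff[of "\<lambda>m. fps_nth (fps_X * f) m * x ^ m" "x * 0"] by simp
    from sums_diff[OF f_sums this] show ?thesis by (simp add: F_def left_diff_distrib)
  qed
  then have F_root: "(\<lambda>m. fps_nth F m * x ^ m) sums 0" by simp
  obtain C where C: "0 \<le> C"
    "\<And>m. \<bar>omega alpha dt k i (Suc m) - omega alpha dt k i m\<bar> \<le> C * real (Suc m) powr (- (2 + alpha))"
    using omega_diff_bound[OF assms(1,3-5)] by blast
  \<comment> \<open>The extra \<open>cmod z\<close> covers m = 0, where the constant term -z of the
    symbol enters the difference.\<close>
  have F_bound: "cmod (fps_nth F (Suc m)) \<le> (C + cmod z) * real (Suc m) powr (- (2 + alpha))" for m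
  proof -
    have "fps_nth F (Suc m) = complex_of_real (omega alpha dt k i (Suc m) - omega alpha dt k i m) + (if m = 0 then z else 0)"
      by (simp add: F_def f_def symbol_nth left_diff_distrib)
    then have "cmod (fps_nth F (Suc m)) \<le> \<bar>omega alpha dt k i (Suc m) - omega alpha dt k i m\<bar> + cmod (if m = 0 then z else 0)"
      by (metis norm_of_real norm_triangle_ineq)
    also have "\<dots> \<le> C * real (Suc m) powr (- (2 + alpha)) + cmod z * real (Suc m) powr (- (2 + alpha))"
      using C(2)[of m] by (intro add_mono) auto
    finally show ?thesis by (simp add: algebra_simps)
  qed
  obtain q where q: "F = (fps_X - fps_const x) * q" "summable (\<lambda>n. cmod (fps_nth q n))"
    using l1_linear_factor[OF assms(1) _ assms(6) F_bound F_root] C(1) by auto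
  have "z * (1 - x) = 0"
  proof (rule c0_solution_at_disc_point[OF q(2) _ assms(6)])
    have "u \<longlonglongrightarrow> 0" using ex by (intro lim) auto
    then have "(\<lambda>n. u (Suc n) - u n) \<longlonglongrightarrow> 0 - 0" by (intro tendsto_diff LIMSEQ_Suc)
    then have "(\<lambda>n. fps_nth Y (Suc n)) \<longlonglongrightarrow> 0" by (simp add: Y_def V_def left_diff_distrib)
    then show "fps_nth Y \<longlonglongrightarrow> 0" by (rule LIMSEQ_imp_Suc)
    show "fps_nth Y j = 0" if "j < k" for j
      using that ex(1) by (simp add: Y_def V_def left_diff_distrib)
    have "(fps_X - fps_const x) * q * Y = (1 - fps_X) * ((1 - fps_X) * (f * V))"
      unfolding q(1)[symmetric] F_def Y_def by (simp only: mult_ac)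
    then show "(fps_X - fps_const x) * q * Y = fps_const z * (1 - fps_X) * fps_X ^ k"
      unfolding Xk by (simp only: mult_ac)
  qed (use assms in simp)
  then show False using \<open>z \<noteq> 0\<close> \<open>x \<noteq> 1\<close> by simp
qed

theorem theorem3p8:
  fixes alpha dt :: real and k i :: nat
  assumes "0 < alpha" "alpha < 1" "0 < dt" "1 \<le> i" "i \<le> k" "k \<le> 6"
  shows "summable (\<lambda>m. \<bar>omega alpha dt k i m\<bar>) \<and>
         stab_region alpha dt k i =
           - {(\<Sum>m. complex_of_real (omega alpha dt k i m) * \<xi> ^ m) | \<xi>. cmod \<xi> \<le> 1}"
proof
  show "summable (\<lambda>m. \<bar>omega alpha dt k i m\<bar>)" using assms by (intro summable_omega)
  show "stab_region alpha dt k i =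
           - {(\<Sum>m. complex_of_real (omega alpha dt k i m) * \<xi> ^ m) | \<xi>. cmod \<xi> \<le> 1}"
    using not_mem_stab_region[OF assms(1-5)] mem_stab_region[OF assms(1,3-5)] by blast
qed

end
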